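(* Let $\mathsf{R}=\mathbb{C}[\mathsf{t}_1,\mathsf{t}_2,\mathsf{t}_3,\mathsf{t}_4,\mathsf{s}_{11},\mathsf{s}_{22},\mathsf{s}_{33},\mathsf{s}_{44},\mathsf{s}_{12},\mathsf{s}_{23},\mathsf{s}_{34},\mathsf{s}_{14}]$ be the $\mathbb{C}$-subalgebra of $\mathsf{T}_4$ generated by the listed elements. Then $\mathsf{R}$ is a polynomial ring (in these twelve generators, i.e. they are algebraically independent over $\mathbb{C}$), and as an $\mathsf{R}$-module, $\mathsf{T}_4$ is freely generated by $\mathsf{E}$, where \begin{align*} \mathsf{E}&=\{1,\mathsf{s}_{13},\mathsf{s}_{24},\mathsf{s}_{13}\mathsf{s}_{24}\}\cup\big\{\mathsf{s}_{13}^k,\ \mathsf{s}_{13}^k\mathsf{s}_{24},\ \mathsf{s}_{24}^k,\ \mathsf{s}_{24}^k\mathsf{s}_{13}\colon k\ge 2\big\}\\ &\quad\cup\big\{\mathsf{s}_{13}^k\mathsf{s}_{123},\ \mathsf{s}_{13}^k\mathsf{s}_{134},\ \mathsf{s}_{24}^k\mathsf{s}_{124},\ \mathsf{s}_{24}^k\mathsf{s}_{234}\colon k\ge 0\big\}. \end{align*}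
   Context: Let $\mathsf{M}$ be the $\mathbb{C}$-algebra of $2\times2$ complex matrices, with identity matrix $\mathbf{e}$. $\mathsf{T}_4$ denotes the ring of ${\rm GL}(2,\mathbb{C})$-invariants of $4$-tuples of $2\times 2$ matrices, i.e. the ring of polynomial functions on $\mathsf{M}^4$ invariant under simultaneous conjugation. For $\mathbf{x}\in\mathsf{M}$ put $[[\mathbf{x}]]=\mathbf{x}-\frac12{\rm tr}(\mathbf{x})\,\mathbf{e}$. For $1\le i_1,\ldots,i_r\le 4$, let $\mathsf{t}_{i_1\cdots i_r},\mathsf{s}_{i_1\cdots i_r}\in\mathsf{T}_4$ be the functions $$\mathsf{t}_{i_1\cdots i_r}(\mathbf{x}_1,\ldots,\mathbf{x}_4)={\rm tr}(\mathbf{x}_{i_1}\cdots\mathbf{x}_{i_r}),\qquad \mathsf{s}_{i_1\cdots i_r}(\mathbf{x}_1,\ldots,\mathbf{x}_4)={\rm tr}([[\mathbf{x}_{i_1}]]\cdots[[\mathbf{x}_{i_r}]]).$$ *)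

theory Defs
  imports "HOL-Analysis.Analysis" "HOL-Library.Function_Algebras" "HOL-Library.Poly_Mapping"
begin

text \<open>
  Complex-valued functions form a commutative ring under the pointwise operations of
  \<^theory>\<open>HOL-Library.Function_Algebras\<close>; the constant functions make it a complex algebra.
\<close>

inductive_set generated_subalgebra :: "('x \<Rightarrow> complex) set \<Rightarrow> ('x \<Rightarrow> complex) set"
  for G :: "('x \<Rightarrow> complex) set" where
  const: "(\<lambda>_. c) \<in> generated_subalgebra G"
| gen: "f \<in> G \<Longrightarrow> f \<in> generated_subalgebra G"
| add: "f \<in> generated_subalgebra G \<Longrightarrow> g \<in> generated_subalgebra G \<Longrightarrow> f + g \<in> generated_subalgebra G"
| mult: "f \<in> generated_subalgebra G \<Longrightarrow> g \<in> generated_subalgebra G \<Longrightarrow> f * g \<in> generated_subalgebra G"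

text \<open>
  A polynomial with complex coefficients in variables indexed by naturals is a finitely supported
  map from monomials (finitely supported exponent maps) to coefficients; variable \<open>i\<close> is
  evaluated at the \<open>i\<close>-th entry of the list.
\<close>

definition poly_eval ::
  "('x \<Rightarrow> complex) list \<Rightarrow> ((nat \<Rightarrow>\<^sub>0 nat) \<Rightarrow>\<^sub>0 complex) \<Rightarrow> ('x \<Rightarrow> complex)" where
  "poly_eval fs p =
    (\<Sum>m\<in>Poly_Mapping.keys p. (\<lambda>_. Poly_Mapping.lookup p m) *
       (\<Prod>i\<in>Poly_Mapping.keys m. (fs ! i) ^ Poly_Mapping.lookup m i))"

definition algebraically_independent :: "('x \<Rightarrow> complex) list \<Rightarrow> bool" where
  "algebraically_independent fs \<longleftrightarrow>
    (\<forall>p. (\<forall>m\<in>Poly_Mapping.keys p. Poly_Mapping.keys m \<subseteq> {..<length fs}) \<longrightarrow>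
         poly_eval fs p = 0 \<longrightarrow> p = 0)"

definition module_span :: "'a::comm_ring_1 set \<Rightarrow> 'a set \<Rightarrow> 'a set" where
  "module_span R B = {\<Sum>b\<in>F. c b * b | F c. finite F \<and> F \<subseteq> B \<and> (\<forall>b\<in>F. c b \<in> R)}"

definition module_independent :: "'a::comm_ring_1 set \<Rightarrow> 'a set \<Rightarrow> bool" where
  "module_independent R B \<longleftrightarrow>
    (\<forall>F c. finite F \<longrightarrow> F \<subseteq> B \<longrightarrow> (\<forall>b\<in>F. c b \<in> R) \<longrightarrow>
           (\<Sum>b\<in>F. c b * b) = 0 \<longrightarrow> (\<forall>b\<in>F. c b = 0))"

text \<open>
  Here \<open>R\<close> is a subring of the ambient ring and \<open>M\<close> is an \<open>R\<close>-submodule of the ambient ring.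
\<close>

definition freely_generated :: "'a::comm_ring_1 set \<Rightarrow> 'a set \<Rightarrow> 'a set \<Rightarrow> bool" where
  "freely_generated R M B \<longleftrightarrow> M = module_span R B \<and> module_independent R B"

type_synonym mat2 = "complex^2^2"

text \<open>
  Four-tuples are indexed by the numeral type \<open>4\<close>, whose elements are 1, 2, 3 and 4
  (the last one coincides with 0).
\<close>

type_synonym mat2_tuple = "mat2^4"

definition polynomial_functions :: "(mat2_tuple \<Rightarrow> complex) set" where
  "polynomial_functions = generated_subalgebra {\<lambda>x. x $ i $ j $ k | i j k. True}"

definition T4 :: "(mat2_tuple \<Rightarrow> complex) set" where
  "T4 = {f \<in> polynomial_functions.
           \<forall>g::mat2. invertible g \<longrightarrow> (\<forall>x. f (\<chi> i. g ** x $ i ** matrix_inv g) = f x)}"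

text \<open>\<^term>\<open>mat c\<close> is the scalar matrix with diagonal entries \<open>c\<close>.\<close>

definition traceless :: "mat2 \<Rightarrow> mat2" where
  "traceless x = x - mat (trace x / 2)"

definition mat_word :: "mat2 list \<Rightarrow> mat2" where
  "mat_word xs = foldr (**) xs (mat 1)"

definition t_fun :: "4 list \<Rightarrow> mat2_tuple \<Rightarrow> complex" where
  "t_fun is x = trace (mat_word (map (\<lambda>i. x $ i) is))"

definition s_fun :: "4 list \<Rightarrow> mat2_tuple \<Rightarrow> complex" where
  "s_fun is x = trace (mat_word (map (\<lambda>i. traceless (x $ i)) is))"

definition R_generators :: "(mat2_tuple \<Rightarrow> complex) list" where
  "R_generators =
    [t_fun [1], t_fun [2], t_fun [3], t_fun [4],
     s_fun [1,1], s_fun [2,2], s_fun [3,3], s_fun [4,4],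
     s_fun [1,2], s_fun [2,3], s_fun [3,4], s_fun [1,4]]"

definition R_alg :: "(mat2_tuple \<Rightarrow> complex) set" where
  "R_alg = generated_subalgebra (set R_generators)"

definition E_set :: "(mat2_tuple \<Rightarrow> complex) set" where
  "E_set = {1, s_fun [1,3], s_fun [2,4], s_fun [1,3] * s_fun [2,4]}
     \<union> (\<Union>k\<in>{2..}. {s_fun [1,3] ^ k, s_fun [1,3] ^ k * s_fun [2,4], s_fun [2,4] ^ k, s_fun [2,4] ^ k * s_fun [1,3]})
     \<union> (\<Union>k. {s_fun [1,3] ^ k * s_fun [1,2,3], s_fun [1,3] ^ k * s_fun [1,3,4],
              s_fun [2,4] ^ k * s_fun [1,2,4], s_fun [2,4] ^ k * s_fun [2,3,4]})"

end

theory Submission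
  imports Defs "HOL-Computational_Algebra.Polynomial"
begin

text \<open>
  Write \<open>a = s\<^sub>1\<^sub>3\<close> and \<open>b = s\<^sub>2\<^sub>4\<close>.

  \<^emph>\<open>Generation.\<close> Where \<open>s\<^sub>1\<^sub>1\<close> does not vanish, the first matrix can generically be diagonalised; its traceless
  part becomes \<open>diag(\<lambda>, - \<lambda>)\<close> with \<open>2 \<lambda>\<^sup>2 = s\<^sub>1\<^sub>1\<close>. The remaining invariance under the diagonal torus is elementary,
  and averaging over the two signs of \<open>\<lambda>\<close> shows that \<open>s\<^sub>1\<^sub>1\<^sup>k * f\<close> is a polynomial in traces for every invariant \<open>f\<close>.
  Trace polynomials lie in the span of \<open>E\<close>: the vanishing \<open>4 \<times> 4\<close> Gram determinant has leading term
  \<open>a\<^sup>2 b\<^sup>2\<close>, the linear relations between the \<open>s\<^sub>i\<^sub>j\<^sub>k\<close> remove \<open>a s\<^sub>1\<^sub>2\<^sub>4\<close>, \<open>a s\<^sub>2\<^sub>3\<^sub>4\<close>, \<open>b s\<^sub>1\<^sub>2\<^sub>3\<close>, \<open>b s\<^sub>1\<^sub>3\<^sub>4\<close>, and a product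
  of two \<open>s\<^sub>i\<^sub>j\<^sub>k\<close> is a polynomial in the \<open>s\<^sub>i\<^sub>j\<close>. It remains to divide by \<open>s\<^sub>1\<^sub>1\<close> inside the span of \<open>E\<close>.

  \<^emph>\<open>Independence.\<close> Everything, including this division, follows from independence of \<open>E\<close> over the
  other eleven generators on the hypersurface \<open>s\<^sub>1\<^sub>1 = 0\<close>. There the first traceless part may be taken to be a nilpotent
  Jordan block, and over generic values of the generators the pair \<open>(a, b)\<close> runs over a plane curve of bidegree \<open>(2, 2)\<close>.
  Its behaviour as \<open>a \<rightarrow> 0\<close>, \<open>b \<rightarrow> \<infinity>\<close> shows that no nonzero function of the shape
  \<open>F\<^sub>0(a) + b F\<^sub>1(a) + H\<^sub>0(b) + a H\<^sub>1(b)\<close> vanishes on it.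
\<close>

section \<open>Algebras of polynomial functions\<close>

lemma power_fun_apply: "((f :: 'x \<Rightarrow> 'a::comm_ring_1) ^ k) x = f x ^ k"
  by (induction k) auto

lemma sum_fun_apply: "(\<Sum>i\<in>I. f i :: 'x \<Rightarrow> 'a::comm_monoid_add) x = (\<Sum>i\<in>I. f i x)"
  by (induction I rule: infinite_finite_induct) auto

lemma prod_fun_apply: "(\<Prod>i\<in>I. f i :: 'x \<Rightarrow> 'a::comm_ring_1) x = (\<Prod>i\<in>I. f i x)"
  by (induction I rule: infinite_finite_induct) auto

context
  fixes G :: "('x \<Rightarrow> complex) set"
begin

lemma generated_subalgebra_0: "0 \<in> generated_subalgebra G"
  using generated_subalgebra.const[of 0 G] by (simp add: zero_fun_def)

lemma generated_subalgebra_1: "1 \<in> generated_subalgebra G"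
  using generated_subalgebra.const[of 1 G] by (simp add: one_fun_def)

lemma generated_subalgebra_uminus:
  assumes "f \<in> generated_subalgebra G" shows "- f \<in> generated_subalgebra G"
proof -
  have "- f = (\<lambda>_. -1) * f" by (simp add: fun_eq_iff)
  then show ?thesis using assms by (auto intro: generated_subalgebra.intros)
qed

lemma generated_subalgebra_diff:
  "f \<in> generated_subalgebra G \<Longrightarrow> g \<in> generated_subalgebra G \<Longrightarrow> f - g \<in> generated_subalgebra G"
  using generated_subalgebra.add[of f G "- g"] generated_subalgebra_uminus[of g] by simp

lemma generated_subalgebra_power:
  "f \<in> generated_subalgebra G \<Longrightarrow> f ^ k \<in> generated_subalgebra G"
  by (induction k) (auto intro: generated_subalgebra.mult generated_subalgebra_1)

lemma generated_subalgebra_sum: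
  "(\<And>i. i \<in> I \<Longrightarrow> f i \<in> generated_subalgebra G) \<Longrightarrow> sum f I \<in> generated_subalgebra G"
  by (induction I rule: infinite_finite_induct)
    (auto intro: generated_subalgebra.add generated_subalgebra_0)

lemma generated_subalgebra_prod:
  "(\<And>i. i \<in> I \<Longrightarrow> f i \<in> generated_subalgebra G) \<Longrightarrow> prod f I \<in> generated_subalgebra G"
  by (induction I rule: infinite_finite_induct)
    (auto intro: generated_subalgebra.mult generated_subalgebra_1)

lemmas generated_subalgebra_intros =
  generated_subalgebra.const generated_subalgebra.add generated_subalgebra.mult
  generated_subalgebra_0 generated_subalgebra_1 generated_subalgebra_uminus
  generated_subalgebra_diff generated_subalgebra_power generated_subalgebra_sum
  generated_subalgebra_prod

lemma generated_subalgebra_const_mult: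
  "f \<in> generated_subalgebra G \<Longrightarrow> (\<lambda>x. c * f x) \<in> generated_subalgebra G"
  using generated_subalgebra.mult[OF generated_subalgebra.const[of c]] by (simp add: times_fun_def)

text \<open>Polynomials in one variable are closed under sums and products, so only the generators
  have to be examined along \<open>L\<close>.\<close>

lemma generated_subalgebra_poly_line:
  assumes "f \<in> generated_subalgebra G"
    and "\<And>g. g \<in> G \<Longrightarrow> \<exists>p. \<forall>t::complex. g (L t) = poly p t"
  shows "\<exists>p. \<forall>t. f (L t) = poly p t"
  using assms(1)
proof induction
  case (const c)
  then show ?case by (intro exI[of _ "[:c:]"]) simp
next
  case (gen f)
  then show ?case using assms(2) by blast
next
  case (add f g)
  then show ?case by (metis plus_fun_apply poly_add)
next
  case (mult f g)
  then show ?case by (metis times_fun_apply poly_mult)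
qed

text \<open>Joining \<open>x\<close> to \<open>y\<close> by a path along which both functions become
  polynomials in one variable reduces the claim to the absence of zero divisors in
  \<open>complex poly\<close>.\<close>

lemma generated_subalgebra_domain:
  assumes lines: "\<And>x y. \<exists>L. L 0 = x \<and> L 1 = y \<and> (\<forall>g\<in>G. \<exists>p. \<forall>t::complex. g (L t) = poly p t)"
    and f: "f \<in> generated_subalgebra G" and g: "g \<in> generated_subalgebra G"
    and fg: "\<And>x. f x * g x = 0" and x: "f x \<noteq> 0"
  shows "g y = 0"
proof -
  obtain L where L: "L 0 = x" "L 1 = y" "\<forall>g\<in>G. \<exists>p. \<forall>t::complex. g (L t) = poly p t"
    using lines by blast
  obtain p where p: "\<And>t. f (L t) = poly p t"
    using generated_subalgebra_poly_line[OF f] L(3) by blast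
  obtain q where q: "\<And>t. g (L t) = poly q t"
    using generated_subalgebra_poly_line[OF g] L(3) by blast
  have "poly (p * q) = poly 0" using fg p q by (simp add: fun_eq_iff flip: p q)
  then have "p * q = 0" by (simp only: poly_eq_poly_eq_iff)
  moreover have "p \<noteq> 0" using x L(1) p[of 0] by auto
  ultimately show ?thesis using q[of 1] L(2) by simp
qed

end

lemma poly_eq_0_if_infinitely_many:
  fixes p :: "complex poly"
  assumes "\<And>x. x \<notin> S \<Longrightarrow> poly p x = 0" "finite S"
  shows "p = 0"
proof (rule ccontr)
  assume "p \<noteq> 0"
  then have "finite {x. poly p x = 0}" by (rule poly_roots_finite)
  moreover have "UNIV \<subseteq> S \<union> {x. poly p x = 0}" using assms(1) by auto
  ultimately have "finite (UNIV :: complex set)" using assms(2) by (meson finite_UnI finite_subset)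
  then show False using infinite_UNIV_char_0 by blast
qed

lemma mat2_tuple_line:
  "\<exists>L. L 0 = x \<and> L 1 = y \<and> (\<forall>g\<in>{\<lambda>x::mat2_tuple. x $ i $ j $ k | i j k. True}. \<exists>p. \<forall>t::complex. g (L t) = poly p t)"
proof (intro exI[of _ "\<lambda>t. \<chi> i j k. (1 - t) * x $ i $ j $ k + t * y $ i $ j $ k"] conjI ballI)
  fix g assume "g \<in> {\<lambda>x::mat2_tuple. x $ i $ j $ k | i j k. True}"
  then obtain i j k where g: "g = (\<lambda>x. x $ i $ j $ k)" by blast
  show "\<exists>p. \<forall>t::complex. g (\<chi> i j k. (1 - t) * x $ i $ j $ k + t * y $ i $ j $ k) = poly p t"
    unfolding g by (intro exI[of _ "[:x $ i $ j $ k, y $ i $ j $ k - x $ i $ j $ k:]"]) (simp add: algebra_simps)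
qed (auto simp: vec_eq_iff)

text \<open>Lets an identity of polynomial functions be checked only where \<open>d\<close> does not
  vanish. It serves to cancel \<open>s_fun [1,1]\<close> and to pass from diagonalisable to
  arbitrary tuples.\<close>

lemma polynomial_functions_cancel:
  assumes "d \<in> polynomial_functions" "f \<in> polynomial_functions" "g \<in> polynomial_functions"
    and "d x0 \<noteq> 0" "\<And>x. d x * f x = d x * g x"
  shows "f = g"
proof -
  have "(f - g) y = 0" for y
    using assms unfolding polynomial_functions_def
    by (intro generated_subalgebra_domain[OF mat2_tuple_line, of d "f - g" x0])
      (auto intro: generated_subalgebra_diff simp: algebra_simps)
  then show ?thesis by (simp add: fun_eq_iff)
qed

text \<open>Polynomial functions in twelve variables; the values at arguments \<open>\<ge> 12\<close> are irrelevant.\<close>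

definition coord_polys :: "((nat \<Rightarrow> complex) \<Rightarrow> complex) set" where
  "coord_polys = generated_subalgebra {\<lambda>y. y i | i. i < 12}"

lemma coord_line:
  "\<exists>L. L 0 = x \<and> L 1 = y \<and> (\<forall>g\<in>{\<lambda>y. y i | i::nat. i < 12}. \<exists>p. \<forall>t::complex. g (L t) = poly p t)"
proof (intro exI[of _ "\<lambda>t i. (1 - t) * x i + t * y i"] conjI ballI)
  fix g assume "g \<in> {\<lambda>y::nat\<Rightarrow>complex. y i | i::nat. i < 12}"
  then obtain i where g: "g = (\<lambda>x. x i)" by blast
  show "\<exists>p. \<forall>t::complex. g (\<lambda>i. (1 - t) * x i + t * y i) = poly p t"
    unfolding g by (intro exI[of _ "[:x i, y i - x i:]"]) (simp add: algebra_simps)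
qed auto

lemma coord_polys_domain:
  assumes "f \<in> coord_polys" "g \<in> coord_polys" "\<And>y. f y * g y = 0" "f y0 \<noteq> 0"
  shows "g y = 0"
  using generated_subalgebra_domain[OF coord_line] assms unfolding coord_polys_def by blast

section \<open>Division of a polynomial function by a coordinate\<close>

lemma coord_polys_subst_0:
  assumes "f \<in> coord_polys" shows "(\<lambda>y. f (y(i := 0))) \<in> coord_polys"
  using assms unfolding coord_polys_def
proof induction
  case (gen f)
  then obtain j where "f = (\<lambda>y. y j)" "j < 12" by blast
  then show ?case
    by (cases "j = i") (auto intro!: generated_subalgebra.const generated_subalgebra.gen)
next
  case (add f g)
  then show ?case using generated_subalgebra.add by (fastforce simp: plus_fun_def)
next
  case (mult f g)
  then show ?case using generated_subalgebra.mult by (fastforce simp: times_fun_def)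
qed (rule generated_subalgebra.const)

text \<open>Induction on the construction of \<open>f\<close>. Products use
  \<open>f g - f0 g0 = (f - f0) g + f0 (g - g0)\<close>, where \<open>f0\<close> and
  \<open>g0\<close> are the restrictions to \<open>y i = 0\<close>.\<close>

lemma coord_polys_divide:
  assumes "f \<in> coord_polys"
  obtains g where "g \<in> coord_polys" "\<And>y. f y = f (y(i := 0)) + y i * g y"
proof -
  define D where "D f g \<longleftrightarrow> (\<forall>y. f y - f (y(i := 0)) = y i * g y)"
    for f g :: "(nat \<Rightarrow> complex) \<Rightarrow> complex"
  have "\<exists>g\<in>coord_polys. D f g"
    using assms unfolding coord_polys_def
  proof induction
    case (const c)
    have "D (\<lambda>_. c) 0" by (simp add: D_def)
    then show ?case using generated_subalgebra_0 by blast
  next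
    case (gen f)
    then obtain j where "f = (\<lambda>y. y j)" "j < 12" by blast
    then have "D f (if j = i then 1 else 0)" by (simp add: D_def)
    moreover have "(if j = i then 1 else 0) \<in> generated_subalgebra {\<lambda>y::nat \<Rightarrow> complex. y i | i. i < 12}"
      by (simp add: generated_subalgebra_0 generated_subalgebra_1)
    ultimately show ?case by (rule bexI)
  next
    case (add f g)
    then obtain f' g' where h: "f' \<in> coord_polys" "g' \<in> coord_polys" "D f f'" "D g g'"
      unfolding coord_polys_def by blast
    have "D (f + g) (f' + g')"
      unfolding D_def
    proof
      fix y
      have "(f + g) y - (f + g) (y(i := 0)) = (f y - f (y(i := 0))) + (g y - g (y(i := 0)))" by simp
      then show "(f + g) y - (f + g) (y(i := 0)) = y i * (f' + g') y"
        unfolding h(3,4)[unfolded D_def, rule_format] by (simp add: distrib_left)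
    qed
    moreover have "f' + g' \<in> coord_polys" using h(1,2) unfolding coord_polys_def by (rule generated_subalgebra.add)
    ultimately show ?case unfolding coord_polys_def by blast
  next
    case (mult f g)
    then obtain f' g' where h: "f' \<in> coord_polys" "g' \<in> coord_polys" "D f f'" "D g g'"
      unfolding coord_polys_def by blast
    have "D (f * g) (f' * g + (\<lambda>y. f (y(i := 0))) * g')"
      unfolding D_def
    proof
      fix y
      have "(f * g) y - (f * g) (y(i := 0))
          = (f y - f (y(i := 0))) * g y + f (y(i := 0)) * (g y - g (y(i := 0)))"
        by (simp add: algebra_simps)
      then show "(f * g) y - (f * g) (y(i := 0)) = y i * (f' * g + (\<lambda>y. f (y(i := 0))) * g') y"
        unfolding h(3,4)[unfolded D_def, rule_format] by (simp add: algebra_simps)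
    qed
    moreover have "f' * g + (\<lambda>y. f (y(i := 0))) * g' \<in> coord_polys"
      using mult.hyps h coord_polys_subst_0[of f i] unfolding coord_polys_def
      by (intro generated_subalgebra.add generated_subalgebra.mult) auto
    ultimately show ?case unfolding coord_polys_def by blast
  qed
  then obtain g where g: "g \<in> coord_polys" "D f g" by blast
  show ?thesis
  proof
    show "g \<in> coord_polys" by (rule g)
    show "f y = f (y(i := 0)) + y i * g y" for y
    proof -
      have "f y = f (y(i := 0)) + (f y - f (y(i := 0)))" by (simp only: add_diff_cancel_left' add_diff_eq)
      also have "f y - f (y(i := 0)) = y i * g y" using g(2) unfolding D_def by blast
      finally show ?thesis .
    qed
  qed
qed

text \<open>Monomials are characters of the multiplicative monoid \<open>nat \<Rightarrow> complex\<close>, so Dedekind's argument applies.\<close>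

lemma monoid_characters_independent:
  fixes ch :: "'i \<Rightarrow> ('x::monoid_mult) \<Rightarrow> 'k::field"
  assumes "finite I" "inj_on ch I" "\<And>i. i \<in> I \<Longrightarrow> ch i 1 = 1"
    and "\<And>i x y. i \<in> I \<Longrightarrow> ch i (x * y) = ch i x * ch i y"
    and "\<And>x. (\<Sum>i\<in>I. c i * ch i x) = 0"
  shows "\<forall>i\<in>I. c i = 0"
  using assms
proof (induction I arbitrary: c rule: finite_induct)
  case (insert j I)
  have "c i = 0" if i: "i \<in> I" for i
  proof -
    have "ch i \<noteq> ch j" using insert.prems(1) insert.hyps(2) i by (metis inj_on_def insertCI)
    then obtain z where z: "ch i z \<noteq> ch j z" by (auto simp only: fun_eq_iff)
    \<comment> \<open>Subtracting \<open>ch j z\<close> times the relation at \<open>x\<close> from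
      the relation at \<open>z * x\<close> eliminates the character \<open>ch j\<close>.\<close>
    have "(\<Sum>i\<in>I. (c i * (ch i z - ch j z)) * ch i x) = 0" for x
    proof -
      have "(\<Sum>i\<in>I. (c i * (ch i z - ch j z)) * ch i x)
        = (\<Sum>i\<in>insert j I. (c i * (ch i z - ch j z)) * ch i x)"
        using insert.hyps by simp
      also have "\<dots> = (\<Sum>i\<in>insert j I. c i * ch i (z * x) - ch j z * (c i * ch i x))"
        using insert.prems(3) by (intro sum.cong refl) (simp add: algebra_simps)
      also have "\<dots> = (\<Sum>i\<in>insert j I. c i * ch i (z * x)) - ch j z * (\<Sum>i\<in>insert j I. c i * ch i x)"
        by (simp only: sum_subtractf sum_distrib_left)
      finally have "(\<Sum>i\<in>I. (c i * (ch i z - ch j z)) * ch i x) = \<dots>" .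
      then show ?thesis using insert.prems(4) by simp
    qed
    with insert.IH[of "\<lambda>i. c i * (ch i z - ch j z)"] insert.prems
    have "\<forall>i\<in>I. c i * (ch i z - ch j z) = 0" by auto
    then show ?thesis using z i by auto
  qed
  moreover from this have "c j = 0"
    using insert.prems(4)[of 1] insert.prems(2) insert.hyps by simp
  ultimately show ?case by simp
qed simp

section \<open>Polynomials are determined by their values\<close>

definition monomial_fun :: "(nat \<Rightarrow>\<^sub>0 nat) \<Rightarrow> (nat \<Rightarrow> complex) \<Rightarrow> complex" where
  "monomial_fun m y = (\<Prod>i\<in>Poly_Mapping.keys m. y i ^ Poly_Mapping.lookup m i)"

lemma inj_monomial_fun: "inj monomial_fun"
proof
  fix m m' :: "nat \<Rightarrow>\<^sub>0 nat" assume eq: "monomial_fun m = monomial_fun m'"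
  \<comment> \<open>The point with entry 2 at \<open>i\<close> and 1 elsewhere turns a monomial into
    a power of 2 whose exponent is that of variable \<open>i\<close>.\<close>
  have val: "monomial_fun m (\<lambda>j. if j = i then 2 else 1) = 2 ^ Poly_Mapping.lookup m i" for m i
  proof (cases "i \<in> Poly_Mapping.keys m")
    case True
    have "monomial_fun m (\<lambda>j. if j = i then 2 else 1)
      = (\<Prod>j\<in>Poly_Mapping.keys m. if j = i then 2 ^ Poly_Mapping.lookup m i else 1)"
      unfolding monomial_fun_def by (intro prod.cong) auto
    then show ?thesis using True by simp
  next
    case False
    then have "monomial_fun m (\<lambda>j. if j = i then 2 else 1) = (\<Prod>j\<in>Poly_Mapping.keys m. 1)"
      unfolding monomial_fun_def by (intro prod.cong) auto
    then show ?thesis using False by (simp add: in_keys_iff)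
  qed
  have "Poly_Mapping.lookup m i = Poly_Mapping.lookup m' i" for i
  proof -
    have "(of_nat (2 ^ Poly_Mapping.lookup m i) :: complex) = of_nat (2 ^ Poly_Mapping.lookup m' i)"
      using val[of m i] val[of m' i] eq by simp
    then have "(2::nat) ^ Poly_Mapping.lookup m i = 2 ^ Poly_Mapping.lookup m' i"
      by (simp only: of_nat_eq_iff)
    then show ?thesis by simp
  qed
  then show "m = m'" by (rule poly_mapping_eqI)
qed

lemma poly_mapping_eq_0_if_vanishing:
  fixes p :: "(nat \<Rightarrow>\<^sub>0 nat) \<Rightarrow>\<^sub>0 complex"
  assumes "\<And>y. (\<Sum>m\<in>Poly_Mapping.keys p. Poly_Mapping.lookup p m * monomial_fun m y) = 0"
  shows "p = 0"
proof -
  have "\<forall>m\<in>Poly_Mapping.keys p. Poly_Mapping.lookup p m = 0"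
  proof (rule monoid_characters_independent[where ch = monomial_fun])
    show "inj_on monomial_fun (Poly_Mapping.keys p)" using inj_monomial_fun by (rule inj_on_subset) simp
  qed (auto simp: monomial_fun_def power_mult_distrib prod.distrib assms[unfolded monomial_fun_def])
  then have "Poly_Mapping.keys p = {}" by (auto simp: in_keys_iff simp del: keys_eq_empty)
  then show ?thesis by simp
qed

section \<open>Functions vanishing on a plane curve\<close>

context
  fixes l k :: "complex poly"
begin

text \<open>\<open>(u, v) = red j\<close> is the reduction \<open>w ^ j = u + v * w\<close> modulo
  \<open>w\<^sup>2 = l * w - x\<^sup>2 * k\<close>.\<close>

fun red :: "nat \<Rightarrow> complex poly \<times> complex poly" where
  "red 0 = (1, 0)"
| "red (Suc j) = (let (u, v) = red j in (- ([:0,0,1:] * k * v), u + l * v))"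

lemma red_eval:
  assumes "w\<^sup>2 - poly l a * w + a\<^sup>2 * poly k a = 0"
  shows "w ^ j = poly (fst (red j)) a + poly (snd (red j)) a * w"
proof (induction j)
  case (Suc j)
  obtain u v where uv: "red j = (u, v)" by (cases "red j")
  have "w ^ Suc j = poly u a * w + poly v a * w\<^sup>2" using Suc uv by (simp add: algebra_simps power2_eq_square)
  also have "w\<^sup>2 = poly l a * w - a\<^sup>2 * poly k a" using assms by (simp add: algebra_simps)
  finally show ?case using uv by (simp add: algebra_simps power2_eq_square)
qed simp

text \<open>Modulo the square of the variable the quadratic equation becomes
  \<open>w^2 = l * w\<close>, so \<open>w ^ Suc j\<close> reduces to
  \<open>l ^ j * w\<close>.\<close>

lemma red_mod:
  "[:0,0,1:] dvd fst (red (Suc j)) \<and> [:0,0,1:] dvd snd (red (Suc j)) - l ^ j"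
proof (induction j)
  case (Suc j)
  obtain u v where uv: "red (Suc j) = (u, v)" by (cases "red (Suc j)")
  have eq: "red (Suc (Suc j)) = (- ([:0,0,1:] * k * v), u + l * v)" using uv by (subst red.simps) simp
  have "u + l * v - l ^ Suc j = u + l * (v - l ^ j)" by (simp add: algebra_simps)
  moreover have "[:0,0,1:] dvd u + l * (v - l ^ j)"
    using Suc unfolding uv fst_conv snd_conv by (intro dvd_add dvd_mult) blast+
  ultimately have "[:0,0,1:] dvd u + l * v - l ^ Suc j" by (simp only:)
  moreover have "[:0,0,1:] dvd - ([:0,0,1:] * k * v)" by (simp only: dvd_minus_iff mult.assoc dvd_triv_left)
  ultimately show ?case unfolding eq fst_conv snd_conv by blast
qed simp

context
  assumes l0: "poly l 0 \<noteq> 0"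
begin

text \<open>For all but finitely many \<open>a\<close> the quadratic equation has two distinct roots.\<close>

lemma linear_on_curve_eq_0:
  fixes S T :: "complex poly"
  assumes "\<And>a w. a \<noteq> 0 \<Longrightarrow> w\<^sup>2 - poly l a * w + a\<^sup>2 * poly k a = 0 \<Longrightarrow> poly S a + poly T a * w = 0"
  shows "S = 0" "T = 0"
proof -
  \<comment> \<open>The discriminant of the quadratic. At 0 it equals the square of
    \<open>poly l 0\<close>, hence it is not the zero polynomial.\<close>
  let ?d = "l\<^sup>2 - 4 * [:0,0,1:] * k"
  have "poly ?d 0 \<noteq> 0" using l0 by simp
  then have "?d \<noteq> 0" by (metis poly_0)
  then have fin: "finite (insert 0 {a. poly ?d a = 0})" using poly_roots_finite by blast
  have *: "poly S a = 0 \<and> poly T a = 0" if a: "a \<notin> insert 0 {a. poly ?d a = 0}" for a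
  proof -
    define s where "s = csqrt ((poly l a)\<^sup>2 - 4 * a\<^sup>2 * poly k a)"
    have s2: "s\<^sup>2 = (poly l a)\<^sup>2 - 4 * a\<^sup>2 * poly k a" unfolding s_def by simp
    then have "s \<noteq> 0" using a by (auto simp: power2_eq_square algebra_simps)
    have root: "((poly l a + t) / 2)\<^sup>2 - poly l a * ((poly l a + t) / 2) + a\<^sup>2 * poly k a = 0" if "t\<^sup>2 = s\<^sup>2" for t
    proof -
      have "((poly l a + t) / 2)\<^sup>2 - poly l a * ((poly l a + t) / 2) + a\<^sup>2 * poly k a
        = (t\<^sup>2 - (poly l a)\<^sup>2) / 4 + a\<^sup>2 * poly k a" by (simp add: power2_eq_square field_simps)
      then show ?thesis using that s2 by simp
    qed
    have 1: "poly S a + poly T a * ((poly l a + s) / 2) = 0" using a by (intro assms root) auto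
    have 2: "poly S a + poly T a * ((poly l a + - s) / 2) = 0" using a by (intro assms root) auto
    have "poly T a * s = 0" using 1 2 by (simp add: field_simps)
    then show ?thesis using 1 \<open>s \<noteq> 0\<close> by simp
  qed
  show "S = 0" "T = 0" using poly_eq_0_if_infinitely_many[OF _ fin] * by blast+
qed

text \<open>This is the limit of \<open>a\<close> to 0 and \<open>b\<close> to infinity in algebraic
  form. With \<open>w = a^2 * b\<close>, multiplication by \<open>a ^ (2 * J)\<close> clears
  denominators, and reduction modulo the quadratic leaves \<open>S + T * w\<close>, so
  \<open>T = 0\<close>. Modulo the square of the variable only the term \<open>j = J\<close>
  survives in \<open>T\<close>, as \<open>[:h0 J, h1 J:] * l ^ (J - 1)\<close>; the bound
  \<open>J \<ge> 2\<close> makes the contribution of \<open>F1\<close> divisible as well. Since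
  \<open>l\<close> has nonzero constant term, both coefficients vanish.\<close>

lemma top_coefficients_eq_0:
  fixes F0 F1 :: "complex poly" and h0 h1 :: "nat \<Rightarrow> complex"
  assumes J: "J \<ge> 2"
    and F: "\<And>a b. a \<noteq> 0 \<Longrightarrow> (a\<^sup>2 * b)\<^sup>2 - poly l a * (a\<^sup>2 * b) + a\<^sup>2 * poly k a = 0 \<Longrightarrow>
      poly F0 a + b * poly F1 a + (\<Sum>j\<le>J. (h0 j + a * h1 j) * b ^ j) = 0"
  shows "h0 J = 0 \<and> h1 J = 0"
proof -
  let ?H = "\<lambda>j. [:h0 j, h1 j:] * [:0,1:] ^ (2 * (J - j))"
  define S where "S = (\<Sum>j\<le>J. ?H j * fst (red j)) + [:0,1:] ^ (2 * J) * F0"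
  define T where "T = (\<Sum>j\<le>J. ?H j * snd (red j)) + [:0,1:] ^ (2 * (J - 1)) * F1"
  have "poly S a + poly T a * w = 0"
    if a: "a \<noteq> 0" and w: "w\<^sup>2 - poly l a * w + a\<^sup>2 * poly k a = 0" for a w
  proof -
    define b where "b = w / a\<^sup>2"
    have wb: "w = a\<^sup>2 * b" using a by (simp add: b_def)
    have "(\<Sum>j\<le>J. poly (?H j) a * w ^ j) = a ^ (2 * J) * (\<Sum>j\<le>J. (h0 j + a * h1 j) * b ^ j)"
      unfolding sum_distrib_left
    proof (intro sum.cong refl)
      fix j assume "j \<in> {..J}"
      then have "2 * J = 2 * (J - j) + 2 * j" by simp
      then have "a ^ (2 * J) = a ^ (2 * (J - j)) * a ^ (2 * j)" by (metis power_add)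
      moreover have "poly (?H j) a = (h0 j + a * h1 j) * a ^ (2 * (J - j))" by (simp add: poly_power distrib_right)
      ultimately show "poly (?H j) a * w ^ j = a ^ (2 * J) * ((h0 j + a * h1 j) * b ^ j)"
        by (simp only: wb power_mult_distrib power_mult[symmetric] mult_ac)
    qed
    moreover have "a ^ (2 * (J - 1)) * w = a ^ (2 * J) * b"
    proof -
      have "2 * J = 2 * (J - 1) + 2" using J by simp
      then have "a ^ (2 * J) = a ^ (2 * (J - 1)) * a\<^sup>2" by (metis power_add)
      then show ?thesis by (simp add: wb)
    qed
    moreover have "poly S a + poly T a * w = (\<Sum>j\<le>J. poly (?H j) a * w ^ j) + a ^ (2 * J) * poly F0 a
      + (a ^ (2 * (J - 1)) * w) * poly F1 a"
    proof -
      define X Y where "X = (\<Sum>j\<le>J. poly (?H j) a * poly (fst (red j)) a)"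
        and "Y = (\<Sum>j\<le>J. poly (?H j) a * poly (snd (red j)) a)"
      have "(\<Sum>j\<le>J. poly (?H j) a * w ^ j) = X + Y * w"
        unfolding red_eval[OF w] X_def Y_def by (simp only: sum.distrib sum_distrib_right distrib_left mult.assoc)
      moreover have "poly S a = X + a ^ (2 * J) * poly F0 a" unfolding S_def X_def by (simp add: poly_sum poly_power)
      moreover have "poly T a = Y + a ^ (2 * (J - 1)) * poly F1 a" unfolding T_def Y_def by (simp add: poly_sum poly_power)
      ultimately show ?thesis by (simp only: distrib_right distrib_left add_ac mult_ac)
    qed
    ultimately have "poly S a + poly T a * w
      = a ^ (2 * J) * (poly F0 a + b * poly F1 a + (\<Sum>j\<le>J. (h0 j + a * h1 j) * b ^ j))"
      by (simp add: algebra_simps)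
    then show ?thesis using F[OF a] w wb by simp
  qed
  then have "T = 0" by (rule linear_on_curve_eq_0)
  let ?x2 = "[:0,0,1:] :: complex poly"
  have x2: "?x2 dvd [:0,1:] ^ (2 * i)" if "i > 0" for i
  proof -
    have "[:0,1:] ^ 2 dvd ([:0,1:] :: complex poly) ^ (2 * i)" using that by (intro le_imp_power_dvd) simp
    then show ?thesis by (simp add: power2_eq_square)
  qed
  obtain J' where J': "J = Suc J'" using J by (cases J) auto
  define B where "B = (\<Sum>j<J. ?H j * snd (red j)) + [:0,1:] ^ (2 * (J - 1)) * F1"
  have T: "T = [:h0 J, h1 J:] * snd (red J) + B"
    unfolding T_def B_def lessThan_Suc_atMost[symmetric] by simp
  have B: "?x2 dvd B"
    unfolding B_def
  proof (intro dvd_add dvd_sum)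
    show "?x2 dvd ?H j * snd (red j)" if "j \<in> {..<J}" for j
      using that by (intro dvd_mult2[OF dvd_mult[OF x2]]) simp
    show "?x2 dvd [:0,1:] ^ (2 * (J - 1)) * F1"
      using J by (intro dvd_mult2[OF x2]) simp
  qed
  have "?x2 dvd [:h0 J, h1 J:] * snd (red J) + B"
    unfolding T[symmetric] \<open>T = 0\<close> by (rule dvd_0_right)
  then have "?x2 dvd [:h0 J, h1 J:] * snd (red J)" unfolding dvd_add_left_iff[OF B] .
  moreover have "?x2 dvd [:h0 J, h1 J:] * (snd (red J) - l ^ J')" 
    unfolding J' by (rule dvd_mult[OF conjunct2[OF red_mod]])
  ultimately have "?x2 dvd [:h0 J, h1 J:] * snd (red J) - [:h0 J, h1 J:] * (snd (red J) - l ^ J')" by (rule dvd_diff)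
  then have "?x2 dvd [:h0 J, h1 J:] * l ^ J'" by (simp add: algebra_simps)
  then obtain t where t: "[:h0 J, h1 J:] * l ^ J' = ?x2 * t" by blast
  define m where "m = l ^ J'"
  have m0: "coeff m 0 \<noteq> 0" using l0 by (simp add: m_def poly_0_coeff_0[symmetric] poly_power)
  \<comment> \<open>The two lowest coefficients form a triangular system in \<open>h0 J\<close> and
    \<open>h1 J\<close> with \<open>coeff m 0\<close> on the diagonal.\<close>
  have "coeff ([:h0 J, h1 J:] * m) 0 = 0" "coeff ([:h0 J, h1 J:] * m) 1 = 0"
    unfolding m_def t by simp_all
  then show ?thesis using m0 by simp
qed

text \<open>The top coefficients are stripped off one degree at a time. Once the sum stops at
  \<open>b ^ 1\<close> or earlier, the whole relation is linear in \<open>b\<close> and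
  \<open>linear_on_curve_eq_0\<close> applies.\<close>

lemma vanishing_on_curve:
  fixes F0 F1 :: "complex poly" and h0 h1 :: "nat \<Rightarrow> complex"
  assumes F: "\<And>a b. a \<noteq> 0 \<Longrightarrow> (a\<^sup>2 * b)\<^sup>2 - poly l a * (a\<^sup>2 * b) + a\<^sup>2 * poly k a = 0 \<Longrightarrow>
      poly F0 a + b * poly F1 a + (\<Sum>j\<le>J. (h0 j + a * h1 j) * b ^ j) = 0"
  shows "poly F0 a + b * poly F1 a + (\<Sum>j\<le>J. (h0 j + a * h1 j) * b ^ j) = 0"
  using F
proof (induction J arbitrary: a b)
  case (Suc J)
  show ?case
  proof (cases "J = 0")
    case False
    then have "h0 (Suc J) = 0 \<and> h1 (Suc J) = 0" using Suc.prems by (intro top_coefficients_eq_0) auto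
    then show ?thesis using Suc by simp
  next
    \<comment> \<open>The sum now consists of the terms for 0 and 1, which merge with
      \<open>F0\<close> and \<open>F1\<close>. The factor \<open>a^2\<close> in \<open>S\<close>
      comes from writing \<open>b\<close> as \<open>w / a^2\<close>.\<close>
    case True
    define S where "S = [:0,0,1:] * (F0 + [:h0 0, h1 0:])"
    define T where "T = F1 + [:h0 1, h1 1:]"
    have "poly S a + poly T a * w = 0"
      if a: "a \<noteq> 0" and w: "w\<^sup>2 - poly l a * w + a\<^sup>2 * poly k a = 0" for a w
    proof -
      have "w = a\<^sup>2 * (w / a\<^sup>2)" using a by simp
      moreover from this have "poly F0 a + (w / a\<^sup>2) * poly F1 a + (\<Sum>j\<le>Suc J. (h0 j + a * h1 j) * (w / a\<^sup>2) ^ j) = 0"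
        using Suc.prems[OF a, of "w / a\<^sup>2"] w by simp
      then have "a\<^sup>2 * (poly F0 a + (w / a\<^sup>2) * poly F1 a + (h0 0 + a * h1 0) + (h0 1 + a * h1 1) * (w / a\<^sup>2)) = 0"
        by (simp add: True add.assoc)
      ultimately show ?thesis unfolding S_def T_def using a by (simp add: algebra_simps power2_eq_square)
    qed
    then have "S = 0" "T = 0" by (rule linear_on_curve_eq_0; blast)+
    then have "F0 + [:h0 0, h1 0:] = 0" "T = 0" unfolding S_def by auto
    then have "poly (F0 + [:h0 0, h1 0:]) a + b * poly T a = 0" by simp
    then show ?thesis using True unfolding T_def by (simp add: algebra_simps)
  qed
next
  case 0
  define S where "S = [:0,0,1:] * (F0 + [:h0 0, h1 0:])"
  have "poly S a + poly F1 a * w = 0"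
    if a: "a \<noteq> 0" and w: "w\<^sup>2 - poly l a * w + a\<^sup>2 * poly k a = 0" for a w
  proof -
    have "poly F0 a + (w / a\<^sup>2) * poly F1 a + (h0 0 + a * h1 0) = 0"
      using 0[OF a, of "w / a\<^sup>2"] a w by simp
    then have "a\<^sup>2 * (poly F0 a + (w / a\<^sup>2) * poly F1 a + (h0 0 + a * h1 0)) = 0" by simp
    then show ?thesis unfolding S_def using a by (simp add: algebra_simps power2_eq_square)
  qed
  then have "S = 0" "F1 = 0" by (rule linear_on_curve_eq_0; blast)+
  then have "F0 + [:h0 0, h1 0:] = 0" "F1 = 0" unfolding S_def by auto
  then have "poly (F0 + [:h0 0, h1 0:]) a + b * poly F1 a = 0" by simp
  then show ?case by (simp add: algebra_simps)
qed

lemma vanishing_on_curve_poly: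
  fixes F0 F1 H0 H1 :: "complex poly"
  assumes F: "\<And>a b. a \<noteq> 0 \<Longrightarrow> (a\<^sup>2 * b)\<^sup>2 - poly l a * (a\<^sup>2 * b) + a\<^sup>2 * poly k a = 0 \<Longrightarrow>
      poly F0 a + b * poly F1 a + poly H0 b + a * poly H1 b = 0"
  shows "poly F0 a + b * poly F1 a + poly H0 b + a * poly H1 b = 0"
proof -
  define J where "J = max (degree H0) (degree H1)"
  have ext: "poly H b = (\<Sum>j\<le>J. coeff H j * b ^ j)" if "degree H \<le> J" for H and b :: complex
    unfolding poly_altdef using that
    by (intro sum.mono_neutral_left) (auto simp: not_le coeff_eq_0)
  have eq: "poly H0 b + a * poly H1 b = (\<Sum>j\<le>J. (coeff H0 j + a * coeff H1 j) * b ^ j)" for a b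
    using ext[of H0 b] ext[of H1 b] by (simp add: J_def sum.distrib sum_distrib_left algebra_simps)
  show ?thesis
    using vanishing_on_curve[of F0 F1 "coeff H0" "coeff H1" J a b] F by (simp add: add.assoc eq)
qed

end

end

section \<open>Invariance and trace identities\<close>

text \<open>The traceless part of matrix \<open>i\<close> has rows \<open>(p, q)\<close> and
  \<open>(r, - p)\<close>. These are the coordinates in which traceless matrices are treated as
  vectors of a three-dimensional space.\<close>

definition ent_p :: "4 \<Rightarrow> mat2_tuple \<Rightarrow> complex" where
  "ent_p i x = (x $ i $ 1 $ 1 - x $ i $ 2 $ 2) / 2"
definition ent_q :: "4 \<Rightarrow> mat2_tuple \<Rightarrow> complex" where
  "ent_q i x = x $ i $ 1 $ 2"
definition ent_r :: "4 \<Rightarrow> mat2_tuple \<Rightarrow> complex" where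
  "ent_r i x = x $ i $ 2 $ 1"

lemma traceless_entries:
  "traceless (x $ i) $ 1 $ 1 = ent_p i x" "traceless (x $ i) $ 2 $ 2 = - ent_p i x"
  "traceless (x $ i) $ 1 $ 2 = ent_q i x" "traceless (x $ i) $ 2 $ 1 = ent_r i x"
  by (simp_all add: traceless_def trace_def sum_2 mat_def ent_p_def ent_q_def ent_r_def field_simps)

lemma t_fun_1: "t_fun [i] x = x $ i $ 1 $ 1 + x $ i $ 2 $ 2"
  by (simp add: t_fun_def mat_word_def trace_def sum_2)

lemma s_fun_2: "s_fun [i, j] x = 2 * ent_p i x * ent_p j x + ent_q i x * ent_r j x + ent_r i x * ent_q j x"
  by (simp add: s_fun_def mat_word_def trace_def sum_2 traceless_entries matrix_matrix_mult_def mat_def)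

text \<open>The right-hand side is the determinant of the three coordinate vectors
  \<open>(p, q, r)\<close>, which accounts for the alternating behaviour used below.\<close>

lemma s_fun_3: "s_fun [i, j, k] x =
    ent_p i x * (ent_q j x * ent_r k x - ent_r j x * ent_q k x)
    + ent_q i x * (ent_r j x * ent_p k x - ent_p j x * ent_r k x)
    + ent_r i x * (ent_p j x * ent_q k x - ent_q j x * ent_p k x)"
  by (simp add: s_fun_def mat_word_def trace_def sum_2 traceless_entries matrix_matrix_mult_def mat_def algebra_simps)

lemma s_fun_2_commute: "s_fun [i, j] = s_fun [j, i]"
  by (simp add: fun_eq_iff s_fun_2 algebra_simps)

lemma s_fun_3_rotate: "s_fun [i, j, k] = s_fun [j, k, i]"
  by (simp add: fun_eq_iff s_fun_3 algebra_simps)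

lemma s_fun_3_swap: "s_fun [i, j, k] = - s_fun [j, i, k]"
  by (simp add: fun_eq_iff s_fun_3 algebra_simps)

lemma s_fun_3_refl: "s_fun [i, i, k] = 0" "s_fun [i, k, k] = 0" "s_fun [i, k, i] = 0"
  by (simp_all add: fun_eq_iff s_fun_3 algebra_simps)

text \<open>The bracket is the determinant of the nine pairings. The trace form has Gram determinant
  -2 in the coordinates \<open>(p, q, r)\<close>, so this determinant is -2 times the product of the
  two coordinate determinants.\<close>

lemma s_fun_3_mult:
  "s_fun [i, j, k] * s_fun [l, m, n] = (\<lambda>_. - 1 / 2) *
    (s_fun [i, l] * (s_fun [j, m] * s_fun [k, n] - s_fun [j, n] * s_fun [k, m])
    - s_fun [i, m] * (s_fun [j, l] * s_fun [k, n] - s_fun [j, n] * s_fun [k, l])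
    + s_fun [i, n] * (s_fun [j, l] * s_fun [k, m] - s_fun [j, m] * s_fun [k, l]))"
proof
  fix x
  define pi qi ri pj qj rj pk qk rk where "pi = ent_p i x" and "qi = ent_q i x" and "ri = ent_r i x"
    and "pj = ent_p j x" and "qj = ent_q j x" and "rj = ent_r j x"
    and "pk = ent_p k x" and "qk = ent_q k x" and "rk = ent_r k x"
  define pl ql rl pm qm rm pn qn rn where "pl = ent_p l x" and "ql = ent_q l x" and "rl = ent_r l x"
    and "pm = ent_p m x" and "qm = ent_q m x" and "rm = ent_r m x"
    and "pn = ent_p n x" and "qn = ent_q n x" and "rn = ent_r n x"
  note defs = pi_def qi_def ri_def pj_def qj_def rj_def pk_def qk_def rk_def
    pl_def ql_def rl_def pm_def qm_def rm_def pn_def qn_def rn_def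
  show "(s_fun [i, j, k] * s_fun [l, m, n]) x = ((\<lambda>_. - 1 / 2) *
    (s_fun [i, l] * (s_fun [j, m] * s_fun [k, n] - s_fun [j, n] * s_fun [k, m])
    - s_fun [i, m] * (s_fun [j, l] * s_fun [k, n] - s_fun [j, n] * s_fun [k, l])
    + s_fun [i, n] * (s_fun [j, l] * s_fun [k, m] - s_fun [j, m] * s_fun [k, l]))) x"
    unfolding times_fun_apply plus_fun_apply minus_apply s_fun_2 s_fun_3 defs[symmetric]
    by algebra
qed

text \<open>Cramer's rule: four vectors in a three-dimensional space satisfy a linear relation whose
  coefficients are their 3 by 3 minors. Here that relation is paired with vector
  \<open>i\<close>.\<close>

lemma s_fun_plucker:
  "s_fun [2, 3, 4] * s_fun [1, i] - s_fun [1, 3, 4] * s_fun [2, i]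
    + s_fun [1, 2, 4] * s_fun [3, i] - s_fun [1, 2, 3] * s_fun [4, i] = 0"
proof
  fix x
  define p q r where "p i = ent_p i x" and "q i = ent_q i x" and "r i = ent_r i x" for i
  note defs = p_def q_def r_def
  show "(s_fun [2, 3, 4] * s_fun [1, i] - s_fun [1, 3, 4] * s_fun [2, i]
    + s_fun [1, 2, 4] * s_fun [3, i] - s_fun [1, 2, 3] * s_fun [4, i]) x = 0 x"
    unfolding times_fun_apply plus_fun_apply minus_apply zero_fun_apply s_fun_2 s_fun_3 defs[symmetric]
    by algebra
qed

section \<open>Simultaneous conjugation and membership in \<open>T4\<close>\<close>

lemma matrix_inv_cancel:
  fixes g :: "'a::semiring_1^'n^'n"
  assumes "invertible g"
  shows "g ** matrix_inv g = mat 1" "matrix_inv g ** g = mat 1"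
  using someI_ex[OF assms[unfolded invertible_def]] unfolding matrix_inv_def by auto

lemma mat2_tuple_conj_word:
  fixes g :: mat2
  assumes "invertible g"
  shows "mat_word (map (\<lambda>i. g ** h i ** matrix_inv g) is) = g ** mat_word (map h is) ** matrix_inv g"
proof (induction "is")
  case Nil
  show ?case using assms by (simp add: mat_word_def matrix_inv_cancel)
next
  case (Cons i "is")
  have "g ** h i ** matrix_inv g ** (g ** M ** matrix_inv g) = g ** (h i ** M) ** matrix_inv g" for M
  proof -
    have "g ** h i ** matrix_inv g ** (g ** M ** matrix_inv g) = g ** h i ** (matrix_inv g ** g) ** M ** matrix_inv g"
      by (simp only: matrix_mul_assoc)
    then show ?thesis using assms by (simp add: matrix_inv_cancel matrix_mul_assoc)
  qed
  then show ?case using Cons by (simp add: mat_word_def)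
qed

lemma trace_conj: "invertible (g :: mat2) \<Longrightarrow> trace (g ** M ** matrix_inv g) = trace (M :: mat2)"
  unfolding trace_mul_sym[of "g ** M" "matrix_inv g"]
  by (simp add: matrix_mul_assoc matrix_inv_cancel)

lemma traceless_conj:
  fixes g M :: mat2
  assumes "invertible g"
  shows "traceless (g ** M ** matrix_inv g) = g ** traceless M ** matrix_inv g"
proof -
  have s: "g ** mat c = mat c ** g" for c :: complex
    by (simp add: vec_eq_iff forall_2 matrix_matrix_mult_def sum_2 mat_def)
  have "g ** mat c ** matrix_inv g = mat c" for c
    using assms by (simp add: s matrix_mul_assoc[symmetric] matrix_inv_cancel)
  moreover have "g ** (M - N) ** matrix_inv g = g ** M ** matrix_inv g - g ** N ** matrix_inv g" for N
    by (simp add: vec_eq_iff forall_2 matrix_matrix_mult_def sum_2 algebra_simps)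
  ultimately show ?thesis unfolding traceless_def trace_conj[OF assms] by simp
qed

definition conj_tuple :: "mat2 \<Rightarrow> mat2_tuple \<Rightarrow> mat2_tuple" where
  "conj_tuple g x = (\<chi> i. g ** x $ i ** matrix_inv g)"

lemma t_fun_conj: "invertible g \<Longrightarrow> t_fun is (conj_tuple g x) = t_fun is x"
  by (simp add: t_fun_def conj_tuple_def mat2_tuple_conj_word trace_conj)

lemma s_fun_conj: "invertible g \<Longrightarrow> s_fun is (conj_tuple g x) = s_fun is x"
  by (simp add: s_fun_def conj_tuple_def mat2_tuple_conj_word traceless_conj trace_conj)

lemma T4_iff: "f \<in> T4 \<longleftrightarrow> f \<in> polynomial_functions \<and> (\<forall>g x. invertible g \<longrightarrow> f (conj_tuple g x) = f x)"
  unfolding T4_def conj_tuple_def by auto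

lemma entry_polynomial: "(\<lambda>x. x $ i $ j $ k) \<in> polynomial_functions"
  unfolding polynomial_functions_def by (rule generated_subalgebra.gen) blast

lemma polynomial_functions_intros:
  "f \<in> polynomial_functions \<Longrightarrow> g \<in> polynomial_functions \<Longrightarrow> (\<lambda>x. f x + g x) \<in> polynomial_functions"
  "f \<in> polynomial_functions \<Longrightarrow> g \<in> polynomial_functions \<Longrightarrow> (\<lambda>x. f x - g x) \<in> polynomial_functions"
  "f \<in> polynomial_functions \<Longrightarrow> g \<in> polynomial_functions \<Longrightarrow> (\<lambda>x. f x * g x) \<in> polynomial_functions"
  "f \<in> polynomial_functions \<Longrightarrow> (\<lambda>x. f x / c) \<in> polynomial_functions"
  "(\<lambda>x. c) \<in> polynomial_functions"
  using generated_subalgebra.add[of f _ g] generated_subalgebra_diff[of f _ g]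
    generated_subalgebra.mult[of f _ g] generated_subalgebra_const_mult[of f _ "1 / c"]
    generated_subalgebra.const
  by (auto simp: polynomial_functions_def plus_fun_def fun_diff_def times_fun_def)

lemma t_fun_T4: "t_fun [i] \<in> T4"
  unfolding T4_iff
  by (intro conjI allI impI t_fun_conj) (simp add: t_fun_1[abs_def] polynomial_functions_intros entry_polynomial)

lemma s_fun_2_T4: "s_fun [i, j] \<in> T4"
  unfolding T4_iff
  by (intro conjI allI impI s_fun_conj)
    (simp add: s_fun_2[abs_def] ent_p_def ent_q_def ent_r_def polynomial_functions_intros entry_polynomial)

lemma s_fun_3_T4: "s_fun [i, j, k] \<in> T4"
  unfolding T4_iff
  by (intro conjI allI impI s_fun_conj)
    (simp add: s_fun_3[abs_def] ent_p_def ent_q_def ent_r_def polynomial_functions_intros entry_polynomial)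

lemma T4_const: "(\<lambda>_. c) \<in> T4"
  by (simp add: T4_iff polynomial_functions_intros)

lemma T4_add: "f \<in> T4 \<Longrightarrow> g \<in> T4 \<Longrightarrow> f + g \<in> T4"
  by (auto simp: T4_iff polynomial_functions_def generated_subalgebra.add)

lemma T4_mult: "f \<in> T4 \<Longrightarrow> g \<in> T4 \<Longrightarrow> f * g \<in> T4"
  by (auto simp: T4_iff polynomial_functions_def generated_subalgebra.mult)

lemma generated_subalgebra_T4: "G \<subseteq> T4 \<Longrightarrow> f \<in> generated_subalgebra G \<Longrightarrow> f \<in> T4"
  by (erule generated_subalgebra.induct) (blast intro: T4_const T4_add T4_mult)+

lemma T4_power: "f \<in> T4 \<Longrightarrow> f ^ k \<in> T4"
  by (induction k) (use T4_const[of 1] in \<open>simp_all only: power.simps one_fun_def T4_mult\<close>)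

lemma T4_1: "1 \<in> T4"
  using T4_const[of 1] by (simp only: one_fun_def)

lemma R_alg_T4: "R_alg \<subseteq> T4"
proof
  fix f assume "f \<in> R_alg"
  moreover have "set R_generators \<subseteq> T4"
    by (simp add: R_generators_def t_fun_T4 s_fun_2_T4)
  ultimately show "f \<in> T4" unfolding R_alg_def by (rule generated_subalgebra_T4[rotated])
qed

lemma E_set_T4: "E_set \<subseteq> T4"
  unfolding E_set_def by (safe; intro T4_1 T4_mult T4_power s_fun_2_T4 s_fun_3_T4)

lemma module_span_T4: "module_span R_alg E_set \<subseteq> T4"
proof
  fix f assume "f \<in> module_span R_alg E_set"
  then obtain F c where F: "finite F" "F \<subseteq> E_set" "\<forall>b\<in>F. c b \<in> R_alg" "f = (\<Sum>b\<in>F. c b * b)"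
    unfolding module_span_def by blast
  have "(\<Sum>b\<in>F. c b * b) \<in> T4"
    using F(1-3)
  proof (induction F rule: finite_induct)
    case empty
    then show ?case using T4_const[of 0] by (simp add: zero_fun_def)
  next
    case (insert b F)
    then have "c b * b \<in> T4" using R_alg_T4 E_set_T4 by (intro T4_mult) auto
    moreover have "(\<Sum>b\<in>F. c b * b) \<in> T4" using insert.IH insert.prems by blast
    ultimately show ?case unfolding sum.insert[OF insert.hyps] by (rule T4_add)
  qed
  then show "f \<in> T4" using F by simp
qed

section \<open>Relations on the fibre curve and its square roots \<open>p3\<close>,
  \<open>p4\<close>\<close>

text \<open>Specialising \<open>b\<close> does the work. At the root of \<open>be0 + be1 * b\<close>
  the identity makes \<open>U\<close> constant, and at \<open>b = mu\<close> it makes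
  \<open>B\<close> constant. The coefficient of \<open>a\<close> then equates \<open>D * M\<close>,
  with \<open>M\<close> of degree two, to a polynomial of degree at most one, so
  \<open>D = 0\<close>. The two constants and \<open>C\<close> follow.\<close>

lemma odd_identity_imp_0:
  fixes U B C D :: "complex poly"
  assumes id: "\<And>a b. (poly U a + poly D b * (b - mu)) * (kap + (mu - b) * a)
      + 2 * m * (a * poly B a + m * poly C b + poly D b * (sig * a + tau)) * (be0 + be1 * b) = 0"
    and nz: "m \<noteq> 0" "kap \<noteq> 0" "be1 \<noteq> 0" "be0 + be1 * mu \<noteq> 0"
  shows "U = 0 \<and> B = 0 \<and> C = 0 \<and> D = 0"
proof -
  define b0 where "b0 = - be0 / be1"
  have b0: "be0 + be1 * b0 = 0" using nz by (simp add: b0_def)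
  have "(poly U a + poly D b0 * (b0 - mu)) * (kap + (mu - b0) * a) = 0" for a
    using id[of a b0] unfolding b0 by simp
  then have "poly (U + [:poly D b0 * (b0 - mu):]) a * poly [:kap, mu - b0:] a = 0" for a
    by (simp add: mult.commute)
  then have "poly ((U + [:poly D b0 * (b0 - mu):]) * [:kap, mu - b0:]) = poly 0"
    by (simp only: fun_eq_iff poly_mult poly_0 simp_thms)
  then have "(U + [:poly D b0 * (b0 - mu):]) * [:kap, mu - b0:] = 0" by (simp only: poly_eq_poly_eq_iff)
  then have "U + [:poly D b0 * (b0 - mu):] = 0"
    unfolding mult_eq_0_iff using nz by (metis pCons_eq_0_iff)
  then have "U = - [:poly D b0 * (b0 - mu):]" by (simp only: eq_neg_iff_add_eq_0)
  then have "U = [:- (poly D b0 * (b0 - mu)):]" by simp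
  then obtain u where U: "U = [:u:]" by blast
  define c1 where "c1 = u * kap + 2 * m * (m * poly C mu + tau * poly D mu) * (be0 + be1 * mu)"
  define c2 where "c2 = 2 * m * sig * poly D mu * (be0 + be1 * mu)"
  have "poly (smult (2 * m * (be0 + be1 * mu)) (pCons 0 B)) a = poly [:- c1, - c2:] a" for a
    using id[of a mu] by (simp add: U c1_def c2_def algebra_simps) algebra
  then have "smult (2 * m * (be0 + be1 * mu)) (pCons 0 B) = [:- c1, - c2:]"
    by (simp add: poly_eq_poly_eq_iff[symmetric] fun_eq_iff)
  then have "smult (2 * m * (be0 + be1 * mu)) B = [:- c2:]" by simp
  then have "smult (1 / (2 * m * (be0 + be1 * mu))) (smult (2 * m * (be0 + be1 * mu)) B)
    = [:- c2 / (2 * m * (be0 + be1 * mu)):]" by simp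
  then have "B = [:- c2 / (2 * m * (be0 + be1 * mu)):]" using nz by simp
  then obtain v where B: "B = [:v:]" by blast
  \<comment> \<open>With \<open>U\<close> and \<open>B\<close> constant the identity has degree at
    most one in \<open>a\<close>; its linear coefficient is the difference of the values at 1 and
    0.\<close>
  have lin: "(u + poly D b * (b - mu)) * (mu - b) + 2 * m * (v + poly D b * sig) * (be0 + be1 * b) = 0" for b
    using id[of 1 b] id[of 0 b] by (simp add: U B) algebra
  define M where "M = [:2 * m * sig * be0 - mu\<^sup>2, 2 * mu + 2 * m * sig * be1, -1:]"
  have "poly (D * M) b = poly [:- (u * mu) - 2 * m * v * be0, u - 2 * m * v * be1:] b" for b
    using lin[of b] by (simp add: M_def power2_eq_square algebra_simps)
  then have DM: "D * M = [:- (u * mu) - 2 * m * v * be0, u - 2 * m * v * be1:]"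
    by (simp only: poly_eq_poly_eq_iff[symmetric] fun_eq_iff) simp
  have "D = 0"
  proof (rule ccontr)
    assume "D \<noteq> 0"
    moreover have "M \<noteq> 0" "degree M = 2" by (simp_all add: M_def)
    ultimately have "degree (D * M) \<ge> 2" by (simp add: degree_mult_eq)
    moreover have "degree (D * M) \<le> 1" unfolding DM by simp
    ultimately show False by simp
  qed
  then have "v = 0" using lin[of mu] nz by simp
  then have "u = 0" using lin[of "mu + 1"] \<open>D = 0\<close> by simp
  have "poly C b * poly [:be0, be1:] b = 0" for b
    using id[of 0 b] U B \<open>D = 0\<close> \<open>u = 0\<close> \<open>v = 0\<close> nz by (auto simp: mult.commute)
  then have "poly (C * [:be0, be1:]) = poly 0"
    by (simp only: fun_eq_iff poly_mult poly_0 simp_thms)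
  then have "C * [:be0, be1:] = 0" by (simp only: poly_eq_poly_eq_iff)
  then have "C = 0" unfolding mult_eq_0_iff using nz by (metis pCons_eq_0_iff)
  then show ?thesis using U B \<open>u = 0\<close> \<open>v = 0\<close> \<open>D = 0\<close> by simp
qed

text \<open>The four summands have disjoint supports, namely \<open>a ^ i\<close>,
  \<open>a ^ i * b\<close>, \<open>b ^ (j + 2)\<close> and \<open>a * b ^ (j + 2)\<close>. Setting
  \<open>b = 0\<close>, cancelling one factor \<open>b\<close>, and then setting \<open>a\<close> to
  0 and to 1 separates them.\<close>

lemma even_identity_imp_0:
  fixes F0 F1 Q2 Q3 :: "complex poly"
  assumes id: "\<And>a b. poly F0 a + b * poly F1 a + b\<^sup>2 * poly Q2 b + a * (b\<^sup>2 * poly Q3 b) = 0"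
  shows "F0 = 0 \<and> F1 = 0 \<and> Q2 = 0 \<and> Q3 = 0"
proof -
  have F0: "F0 = 0" using id[of _ 0] by (intro poly_eq_0_if_infinitely_many[of "{}"]) auto
  have "poly F1 a = 0" for a
  proof -
    have "[:poly F1 a:] + [:0,1:] * Q2 + [:0,a:] * Q3 = 0"
    proof (rule poly_eq_0_if_infinitely_many[of "{0}"])
      fix b :: complex assume "b \<notin> {0}"
      moreover have "b * poly ([:poly F1 a:] + [:0,1:] * Q2 + [:0,a:] * Q3) b = 0"
        using id[of a b] by (simp add: F0 power2_eq_square algebra_simps)
      ultimately show "poly ([:poly F1 a:] + [:0,1:] * Q2 + [:0,a:] * Q3) b = 0" by simp
    qed simp
    then have "poly ([:poly F1 a:] + [:0,1:] * Q2 + [:0,a:] * Q3) 0 = 0" by simp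
    then show ?thesis by simp
  qed
  then have F1: "F1 = 0" by (intro poly_eq_0_if_infinitely_many[of "{}"]) auto
  have Q2: "Q2 = 0"
    using id[of 0] by (intro poly_eq_0_if_infinitely_many[of "{0}"]) (auto simp: F0 F1)
  have "Q3 = 0"
    using id[of 1] by (intro poly_eq_0_if_infinitely_many[of "{0}"]) (auto simp: F0 F1 Q2)
  then show ?thesis using F0 F1 Q2 by simp
qed

text \<open>Changing the signs of both \<open>p3\<close> and \<open>p4\<close> preserves the
  hypotheses, so the even and the odd part of the relation vanish separately. Eliminating the two
  roots gives the curve of bidegree (2, 2). There \<open>vanishing_on_curve_poly\<close> applies
  directly to the even part, and to the odd part after multiplication by \<open>2 * m * p4\<close>,
  which turns it into a polynomial in \<open>a\<close> and \<open>b\<close>.\<close>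

lemma curve_independence:
  fixes F0 F1 Q2 Q3 A B C D :: "complex poly"
  assumes rel: "\<And>a b p3 p4. p3\<^sup>2 = al0 + al1 * a + al2 * a\<^sup>2 \<Longrightarrow> p4\<^sup>2 = be0 + be1 * b \<Longrightarrow>
      2 * m * p3 * p4 = kap + mu * a - a * b \<Longrightarrow>
      poly F0 a + b * poly F1 a + b\<^sup>2 * poly Q2 b + a * (b\<^sup>2 * poly Q3 b)
      + (poly A a * (m * p3) + poly B a * (a * p4 - n * p3) + poly C b * (m * p4)
        + poly D b * (p3 * (b - mu) + p4 * (sig * a + tau))) = 0"
    and nz: "m \<noteq> 0" "kap \<noteq> 0" "al0 \<noteq> 0" "be1 \<noteq> 0" "be0 + be1 * mu \<noteq> 0"
  shows "F0 = 0 \<and> F1 = 0 \<and> Q2 = 0 \<and> Q3 = 0 \<and> A = 0 \<and> B = 0 \<and> C = 0 \<and> D = 0"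
proof -
  \<comment> \<open>Squaring the equation for \<open>2 * m * p3 * p4\<close>, inserting the values
    of \<open>p3^2\<close> and \<open>p4^2\<close>, and multiplying by \<open>a^2\<close> gives a
    quadratic equation for \<open>a^2 * b\<close> with these coefficients.\<close>
  define l where "l = [:4 * m\<^sup>2 * be1 * al0, 2 * kap + 4 * m\<^sup>2 * be1 * al1, 2 * mu + 4 * m\<^sup>2 * be1 * al2:]"
  define k where "k = [:kap\<^sup>2 - 4 * m\<^sup>2 * be0 * al0, 2 * kap * mu - 4 * m\<^sup>2 * be0 * al1, mu\<^sup>2 - 4 * m\<^sup>2 * be0 * al2:]"
  have l0: "poly l 0 \<noteq> 0" using nz by (simp add: l_def)
  define ev where "ev a b = poly F0 a + b * poly F1 a + b\<^sup>2 * poly Q2 b + a * (b\<^sup>2 * poly Q3 b)" for a b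
  define od where "od a b p3 p4 = poly A a * (m * p3) + poly B a * (a * p4 - n * p3) + poly C b * (m * p4)
        + poly D b * (p3 * (b - mu) + p4 * (sig * a + tau))" for a b p3 p4
  have point: "\<exists>p3 p4. 2 * m * p3 * p4 = kap + mu * a - a * b \<and> p4\<^sup>2 = be0 + be1 * b \<and> ev a b = 0 \<and> od a b p3 p4 = 0"
    if a: "a \<noteq> 0" and curve: "(a\<^sup>2 * b)\<^sup>2 - poly l a * (a\<^sup>2 * b) + a\<^sup>2 * poly k a = 0" for a b
  proof -
    define alp where "alp = al0 + al1 * a + al2 * a\<^sup>2"
    define bet where "bet = be0 + be1 * b"
    define rho where "rho = (kap + mu * a - a * b) / (2 * m)"
    have mrho: "2 * m * rho = kap + mu * a - a * b" using nz by (simp add: rho_def)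
    have "a\<^sup>2 * ((2 * m * rho)\<^sup>2 - 4 * m\<^sup>2 * (alp * bet)) = 0"
      using curve unfolding mrho alp_def bet_def l_def k_def by simp algebra
    then have "4 * m\<^sup>2 * (rho\<^sup>2 - alp * bet) = 0" using a by (simp add: power_mult_distrib algebra_simps)
    then have prod: "rho\<^sup>2 = alp * bet" using nz by simp
    \<comment> \<open>The signs of the two roots must be compatible with \<open>rho\<close>. A root
      of \<open>alp\<close> is chosen and the other is the quotient; if \<open>alp = 0\<close>, then
      \<open>rho = 0\<close> and any root of \<open>bet\<close> fits.\<close>
    obtain p3 p4 where p: "p3\<^sup>2 = alp" "p4\<^sup>2 = bet" "p3 * p4 = rho"
    proof (cases "alp = 0")
      case True
      then show ?thesis using that[of 0 "csqrt bet"] prod by simp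
    next
      case False
      then have "csqrt alp \<noteq> 0" by simp
      moreover have "(rho / csqrt alp)\<^sup>2 = bet" using False prod by (simp add: power_divide)
      ultimately show ?thesis using that[of "csqrt alp" "rho / csqrt alp"] by simp
    qed
    have 3: "2 * m * p3 * p4 = kap + mu * a - a * b" using mrho p(3) by (simp add: mult.assoc)
    have "ev a b + od a b p3 p4 = 0"
      using rel[of p3 a p4 b] p 3 unfolding alp_def bet_def ev_def od_def by simp
    moreover have "ev a b + od a b (- p3) (- p4) = 0"
      using rel[of "- p3" a "- p4" b] p 3 unfolding alp_def bet_def ev_def od_def by simp
    moreover have "od a b (- p3) (- p4) = - od a b p3 p4" unfolding od_def by (simp add: algebra_simps)
    ultimately have "ev a b = 0" "od a b p3 p4 = 0" by auto
    then show ?thesis using p(2) 3 unfolding bet_def by blast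
  qed
  have "poly F0 a + b * poly F1 a + poly ([:0,0,1:] * Q2) b + a * poly ([:0,0,1:] * Q3) b = 0" for a b
  proof (rule vanishing_on_curve_poly[OF l0])
    show "poly F0 a + b * poly F1 a + poly ([:0,0,1:] * Q2) b + a * poly ([:0,0,1:] * Q3) b = 0"
      if "a \<noteq> 0" "(a\<^sup>2 * b)\<^sup>2 - poly l a * (a\<^sup>2 * b) + a\<^sup>2 * poly k a = 0" for a b
      using point[OF that] unfolding ev_def by (auto simp: power2_eq_square mult.assoc)
  qed
  then have ev0: "F0 = 0 \<and> F1 = 0 \<and> Q2 = 0 \<and> Q3 = 0"
    by (intro even_identity_imp_0) (simp add: power2_eq_square mult.assoc)
  \<comment> \<open>\<open>U\<close> collects what multiplies \<open>p3\<close> in the terms with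
    \<open>A\<close> and \<open>B\<close>. The four polynomials below sort
    \<open>2 * m * p4 * od a b p3 p4\<close> into the shape required by
    \<open>vanishing_on_curve_poly\<close>.\<close>
  define U where "U = smult m A - smult n B"
  define G0 where "G0 = U * [:kap, mu:] + smult (2 * m * be0) ([:0,1:] * B)"
  define G1 where "G1 = [:0,-1:] * U + smult (2 * m * be1) ([:0,1:] * B)"
  define H0 where "H0 = smult kap (D * [:-mu,1:]) + smult (2 * m) ((smult m C + smult tau D) * [:be0,be1:])"
  define H1 where "H1 = D * [:-mu,1:] * [:mu,-1:] + smult (2 * m * sig) (D * [:be0,be1:])"
  have G: "poly G0 a + b * poly G1 a + poly H0 b + a * poly H1 b
    = (poly U a + poly D b * (b - mu)) * (kap + (mu - b) * a)
      + 2 * m * (a * poly B a + m * poly C b + poly D b * (sig * a + tau)) * (be0 + be1 * b)" for a b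
    unfolding G0_def G1_def H0_def H1_def by (simp add: algebra_simps)
  have "poly G0 a + b * poly G1 a + poly H0 b + a * poly H1 b = 0" for a b
  proof (rule vanishing_on_curve_poly[OF l0])
    fix a b
    assume "a \<noteq> 0" "(a\<^sup>2 * b)\<^sup>2 - poly l a * (a\<^sup>2 * b) + a\<^sup>2 * poly k a = 0"
    then obtain p3 p4 where p: "2 * m * p3 * p4 = kap + mu * a - a * b" "p4\<^sup>2 = be0 + be1 * b" "od a b p3 p4 = 0"
      using point by blast
    have "(poly U a + poly D b * (b - mu)) * (kap + mu * a - a * b)
      + 2 * m * (a * poly B a + m * poly C b + poly D b * (sig * a + tau)) * (be0 + be1 * b)
      = 2 * m * p4 * od a b p3 p4"
      unfolding p(1,2)[symmetric] od_def U_def by (simp add: algebra_simps power2_eq_square)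
    then show "poly G0 a + b * poly G1 a + poly H0 b + a * poly H1 b = 0"
      unfolding G p(3) by (simp add: algebra_simps)
  qed
  then have od0: "U = 0 \<and> B = 0 \<and> C = 0 \<and> D = 0"
    unfolding G using nz(1,2,4,5) by (rule odd_identity_imp_0)
  then have "A = 0" using nz(1) by (auto simp: U_def)
  then show ?thesis using ev0 od0 by blast
qed

section \<open>Independence of the basis\<close>

text \<open>\<open>E_elem c k\<close> for \<open>c < 8\<close> enumerates \<^term>\<open>E_set\<close> without repetitions.\<close>

definition E_elem :: "nat \<Rightarrow> nat \<Rightarrow> mat2_tuple \<Rightarrow> complex" where
  "E_elem c k =
    [s_fun [1,3] ^ k, s_fun [1,3] ^ k * s_fun [2,4], s_fun [2,4] ^ (k + 2), s_fun [2,4] ^ (k + 2) * s_fun [1,3],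
     s_fun [1,3] ^ k * s_fun [1,2,3], s_fun [1,3] ^ k * s_fun [1,3,4],
     s_fun [2,4] ^ k * s_fun [1,2,4], s_fun [2,4] ^ k * s_fun [2,3,4]] ! c"

text \<open>Indices 0 to 3 are the traces, 4 to 7 are \<open>s11\<close>, \<open>s22\<close>,
  \<open>s33\<close>, \<open>s44\<close>, and 8 to 11 are \<open>s12\<close>, \<open>s23\<close>,
  \<open>s34\<close>, \<open>s14\<close>. This is the key to the numbered coordinates
  \<open>y i\<close> below.\<close>

definition gens :: "mat2_tuple \<Rightarrow> nat \<Rightarrow> complex" where
  "gens x i = (R_generators ! i) x"

lemma coord_polys_cong:
  assumes "P \<in> coord_polys" "\<And>i. i < 12 \<Longrightarrow> y i = y' i"
  shows "P y = P y'"
  using assms(1) unfolding coord_polys_def by induction (use assms(2) in auto)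

section \<open>Explicit tuples in the fibres of the generators over \<open>s11 = 0\<close>\<close>

definition entries_tuple :: "(4 \<Rightarrow> complex) \<Rightarrow> (4 \<Rightarrow> complex) \<Rightarrow> (4 \<Rightarrow> complex) \<Rightarrow> (4 \<Rightarrow> complex) \<Rightarrow> mat2_tuple" where
  "entries_tuple t p q r = (\<chi> i j k. if j = 1 then (if k = 1 then t i / 2 + p i else q i)
      else (if k = 1 then r i else t i / 2 - p i))"

lemma entries_tuple [simp]:
  "t_fun [i] (entries_tuple t p q r) = t i" "ent_p i (entries_tuple t p q r) = p i"
  "ent_q i (entries_tuple t p q r) = q i" "ent_r i (entries_tuple t p q r) = r i"
  by (simp_all add: entries_tuple_def t_fun_1 ent_p_def ent_q_def ent_r_def)

definition four :: "'a \<Rightarrow> 'a \<Rightarrow> 'a \<Rightarrow> 'a \<Rightarrow> 4 \<Rightarrow> 'a" where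
  "four a b c d i = (if i = 1 then a else if i = 2 then b else if i = 3 then c else d)"

lemma four [simp]: "four a b c d 1 = a" "four a b c d 2 = b" "four a b c d 3 = c" "four a b c d 4 = d"
  by (simp_all add: four_def)

lemma all_less_12:
  "(\<forall>i<12. Q i) \<longleftrightarrow> Q 0 \<and> Q 1 \<and> Q 2 \<and> Q 3 \<and> Q 4 \<and> Q 5 \<and> Q 6 \<and> Q 7 \<and> Q 8 \<and> Q 9 \<and> Q 10 \<and> Q (11::nat)"
  by (simp add: numeral_eq_Suc All_less_Suc2) 

text \<open>The fibre of the generators over a generic point with \<open>s\<^sub>1\<^sub>1 = 0\<close>: the first matrix is
  normalised to the nilpotent Jordan block, and the diagonal of the second traceless part to zero.\<close>

lemma fibre_point:
  fixes y :: "nat \<Rightarrow> complex"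
  assumes m: "y 8 \<noteq> 0" and y4: "y 4 = 0"
    and p3: "p3\<^sup>2 = y 6 / 2 + (- y 9 / y 8) * a + (y 5 / (2 * (y 8)\<^sup>2)) * a\<^sup>2"
    and p4: "p4\<^sup>2 = (y 7 / 2 + y 5 * (y 11)\<^sup>2 / (2 * (y 8)\<^sup>2)) + (- y 11 / y 8) * b"
    and p34: "2 * y 8 * p3 * p4 = (y 8 * y 10 - y 11 * y 9) + (y 5 * y 11 / y 8) * a - a * b"
  shows "\<exists>x. (\<forall>i<12. gens x i = y i) \<and> s_fun [1,1] x = 0 \<and> s_fun [1,3] x = a \<and> s_fun [2,4] x = b \<and>
    s_fun [1,2,3] x = y 8 * p3 \<and> s_fun [1,2,4] x = y 8 * p4 \<and> s_fun [1,3,4] x = a * p4 - y 11 * p3 \<and>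
    s_fun [2,3,4] x = p3 * (b - y 5 * y 11 / y 8) + p4 * ((y 5 / y 8) * a + - y 9)"
proof -
  define m n q e where "m = y 8" and "n = y 11" and "q = y 5 / (2 * m)" and "e = y 9"
  \<comment> \<open>As the first traceless part has \<open>p = 0\<close>, \<open>q = 1\<close>,
    \<open>r = 0\<close>, its pairing with matrix \<open>j\<close> is the entry \<open>r\<close> of
    \<open>j\<close>; this forces 0, \<open>m\<close>, \<open>a\<close>, \<open>n\<close>. The
    entries \<open>q\<close> then solve the equations for \<open>s22\<close>, \<open>s23\<close> and
    \<open>s24\<close>. The values of \<open>s33\<close>, \<open>s44\<close> and \<open>s34\<close>
    remain, and they are the three hypotheses on \<open>p3\<close> and \<open>p4\<close>.\<close>
  define x where "x = entries_tuple (four (y 0) (y 1) (y 2) (y 3)) (four 0 0 p3 p4)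
      (four 1 q ((e - q * a) / m) ((b - q * n) / m)) (four 0 m a n)"
  have m0: "m \<noteq> 0" using m by (simp add: m_def)
  have y5: "y 5 = 2 * m * q" using m0 by (simp add: q_def)
  have P3: "2 * m * p3\<^sup>2 = m * y 6 - 2 * a * (e - q * a)"
    unfolding p3 using m0 by (simp add: y5 m_def[symmetric] e_def[symmetric] field_simps power2_eq_square)
  have P4: "2 * m * p4\<^sup>2 = m * y 7 - 2 * n * (b - q * n)"
    unfolding p4 using m0 by (simp add: y5 m_def[symmetric] n_def[symmetric] field_simps power2_eq_square)
  have P34: "2 * m * p3 * p4 = (m * y 10 - n * e) + 2 * q * n * a - a * b"
    using p34 m0 by (simp add: y5 m_def[symmetric] e_def[symmetric] n_def[symmetric] field_simps)
  have "2 * p3 * p3 + (e - q * a) / m * a + a * ((e - q * a) / m) = (2 * m * p3\<^sup>2 + 2 * a * (e - q * a)) / m"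
    using m0 by (simp add: field_simps power2_eq_square)
  then have 6: "2 * p3 * p3 + (e - q * a) / m * a + a * ((e - q * a) / m) = y 6" unfolding P3 using m0 by simp
  have "2 * p4 * p4 + (b - q * n) / m * n + n * ((b - q * n) / m) = (2 * m * p4\<^sup>2 + 2 * n * (b - q * n)) / m"
    using m0 by (simp add: field_simps power2_eq_square)
  then have 7: "2 * p4 * p4 + (b - q * n) / m * n + n * ((b - q * n) / m) = y 7" unfolding P4 using m0 by simp
  have "2 * p3 * p4 + (e - q * a) / m * n + a * ((b - q * n) / m) = (2 * m * p3 * p4 + n * (e - q * a) + a * (b - q * n)) / m"
    using m0 by (simp add: field_simps)
  then have 10: "2 * p3 * p4 + (e - q * a) / m * n + a * ((b - q * n) / m) = y 10" unfolding P34 using m0 by (simp add: field_simps)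
  have "\<forall>i<12. gens x i = y i"
    unfolding all_less_12 gens_def R_generators_def x_def
    using m0 y4 6 7 10 by (simp add: s_fun_2 y5 m_def n_def e_def)
  moreover have "s_fun [1,1] x = 0" "s_fun [1,3] x = a" by (simp_all add: s_fun_2 x_def)
  moreover have "s_fun [2,4] x = b" using m0 by (simp add: s_fun_2 x_def)
  moreover have "s_fun [1,2,3] x = y 8 * p3" "s_fun [1,2,4] x = y 8 * p4" "s_fun [1,3,4] x = a * p4 - y 11 * p3"
    by (simp_all add: s_fun_3 x_def m_def n_def)
  moreover have "s_fun [2,3,4] x = p3 * (b - 2 * q * n) + p4 * (2 * q * a + - e)"
    using m0 by (simp add: s_fun_3 x_def field_simps)
  then have "s_fun [2,3,4] x = p3 * (b - y 5 * y 11 / y 8) + p4 * ((y 5 / y 8) * a + - y 9)"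
    using m0 by (simp add: y5 m_def[symmetric] n_def e_def)
  ultimately show ?thesis by blast
qed

lemma coeff_sum_monom: "k < K \<Longrightarrow> coeff (\<Sum>k<K. monom (g k) k) k = g k"
  by (simp add: coeff_sum)

lemma sum_less_8: "(\<Sum>c<8. g c) = g 0 + g 1 + g 2 + g 3 + g 4 + g 5 + g 6 + g (7::nat)"
  by (simp add: numeral_eq_Suc add.assoc)

lemma less_8: "c < 8 \<longleftrightarrow> c \<in> {0,1,2,3,4,5,6,7::nat}"
  by auto

text \<open>The coefficients \<open>P c k\<close> are constant along the fibre over
  \<open>y\<close>. They assemble into polynomials \<open>F c\<close> in \<open>a\<close> or
  \<open>b\<close>, and \<open>fibre_point\<close> turns the relation into the hypothesis of
  \<open>curve_independence\<close>. The inequations on \<open>y\<close> are the nondegeneracy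
  conditions of that lemma.\<close>

lemma generic_coefficients_0:
  fixes y :: "nat \<Rightarrow> complex"
  assumes P: "\<And>c k. c < 8 \<Longrightarrow> k < K \<Longrightarrow> P c k \<in> coord_polys"
    and rel: "\<And>x. s_fun [1,1] x = 0 \<Longrightarrow> (\<Sum>k<K. \<Sum>c<8. P c k (gens x) * E_elem c k x) = 0"
    and y4: "y 4 = 0"
    and nz: "y 8 \<noteq> 0" "y 11 \<noteq> 0" "y 6 \<noteq> 0" "y 8 * y 10 - y 11 * y 9 \<noteq> 0" "(y 8)\<^sup>2 * y 7 - (y 11)\<^sup>2 * y 5 \<noteq> 0"
    and ck: "c < 8" "k < K"
  shows "P c k y = 0"
proof -
  define F where "F c = (\<Sum>k<K. monom (P c k y) k)" for c
  have poly_F: "poly (F c) a = (\<Sum>k<K. P c k y * a ^ k)" for c a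
    by (simp add: F_def poly_sum poly_monom)
  have "F 0 = 0 \<and> F 1 = 0 \<and> F 2 = 0 \<and> F 3 = 0 \<and> F 4 = 0 \<and> F 5 = 0 \<and> F 6 = 0 \<and> F 7 = 0"
  proof (rule curve_independence[where m = "y 8" and kap = "y 8 * y 10 - y 11 * y 9" and ?al0.0 = "y 6 / 2"
        and ?al1.0 = "- y 9 / y 8" and ?al2.0 = "y 5 / (2 * (y 8)\<^sup>2)"
        and ?be0.0 = "y 7 / 2 + y 5 * (y 11)\<^sup>2 / (2 * (y 8)\<^sup>2)" and ?be1.0 = "- y 11 / y 8"
        and mu = "y 5 * y 11 / y 8" and n = "y 11" and sig = "y 5 / y 8" and tau = "- y 9"])
    have "(y 7 / 2 + y 5 * (y 11)\<^sup>2 / (2 * (y 8)\<^sup>2)) + - y 11 / y 8 * (y 5 * y 11 / y 8)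
      = ((y 8)\<^sup>2 * y 7 - (y 11)\<^sup>2 * y 5) / (2 * (y 8)\<^sup>2)"
      using nz(1) by (simp add: field_simps power2_eq_square)
    then show "(y 7 / 2 + y 5 * (y 11)\<^sup>2 / (2 * (y 8)\<^sup>2)) + - y 11 / y 8 * (y 5 * y 11 / y 8) \<noteq> 0"
      using nz by simp
  next
    fix a b p3 p4
    assume p: "p3\<^sup>2 = y 6 / 2 + (- y 9 / y 8) * a + (y 5 / (2 * (y 8)\<^sup>2)) * a\<^sup>2"
      "p4\<^sup>2 = (y 7 / 2 + y 5 * (y 11)\<^sup>2 / (2 * (y 8)\<^sup>2)) + (- y 11 / y 8) * b"
      "2 * y 8 * p3 * p4 = (y 8 * y 10 - y 11 * y 9) + (y 5 * y 11 / y 8) * a - a * b"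
    obtain x where x: "\<forall>i<12. gens x i = y i" "s_fun [1,1] x = 0" "s_fun [1,3] x = a" "s_fun [2,4] x = b"
      "s_fun [1,2,3] x = y 8 * p3" "s_fun [1,2,4] x = y 8 * p4" "s_fun [1,3,4] x = a * p4 - y 11 * p3"
      "s_fun [2,3,4] x = p3 * (b - y 5 * y 11 / y 8) + p4 * ((y 5 / y 8) * a + - y 9)"
      using fibre_point[OF nz(1) y4 p] by blast
    have "P c k (gens x) = P c k y" if "c < 8" "k < K" for c k
      using coord_polys_cong[OF P[OF that]] x(1) by blast
    then have "(\<Sum>k<K. \<Sum>c<8. P c k y * E_elem c k x) = 0" using rel[OF x(2)] by simp
    then have "(\<Sum>c<8. \<Sum>k<K. P c k y * E_elem c k x) = 0" by (subst sum.swap)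
    then show "poly (F 0) a + b * poly (F 1) a + b\<^sup>2 * poly (F 2) b + a * (b\<^sup>2 * poly (F 3) b)
      + (poly (F 4) a * (y 8 * p3) + poly (F 5) a * (a * p4 - y 11 * p3) + poly (F 6) b * (y 8 * p4)
        + poly (F 7) b * (p3 * (b - y 5 * y 11 / y 8) + p4 * (y 5 / y 8 * a + - y 9))) = 0"
      unfolding sum_less_8 poly_F E_elem_def
      by (simp add: power_fun_apply x(3-8) sum_distrib_left sum_distrib_right power2_eq_square ac_simps)
  qed (use nz in auto)
  then have "F c = 0" using ck(1) unfolding less_8 by auto
  then show ?thesis using coeff_sum_monom[OF ck(2), of "\<lambda>k. P c k y"] by (simp add: F_def)
qed

lemma coord_in_coord_polys: "i < 12 \<Longrightarrow> (\<lambda>y. y i) \<in> coord_polys"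
  unfolding coord_polys_def by (rule generated_subalgebra.gen) blast

text \<open>The product \<open>D\<close> of the genericity conditions is a nonzero polynomial that
  does not involve \<open>y 4\<close>, so it can be cancelled in the integral domain
  \<open>coord_polys\<close>.\<close>

lemma coefficients_vanish:
  fixes y :: "nat \<Rightarrow> complex"
  assumes P: "\<And>c k. c < 8 \<Longrightarrow> k < K \<Longrightarrow> P c k \<in> coord_polys"
    and rel: "\<And>x. s_fun [1,1] x = 0 \<Longrightarrow> (\<Sum>k<K. \<Sum>c<8. P c k (gens x) * E_elem c k x) = 0"
    and ck: "c < 8" "k < K"
  shows "P c k (y(4 := 0)) = 0"
proof -
  define D :: "(nat \<Rightarrow> complex) \<Rightarrow> complex" where
    "D = (\<lambda>y. y 8) * (\<lambda>y. y 11) * (\<lambda>y. y 6) * ((\<lambda>y. y 8) * (\<lambda>y. y 10) - (\<lambda>y. y 11) * (\<lambda>y. y 9))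
      * ((\<lambda>y. y 8) ^ 2 * (\<lambda>y. y 7) - (\<lambda>y. y 11) ^ 2 * (\<lambda>y. y 5))"
  have "D \<in> coord_polys"
    unfolding D_def coord_polys_def
    by (intro generated_subalgebra.mult generated_subalgebra_diff generated_subalgebra_power
        coord_in_coord_polys[unfolded coord_polys_def]) simp_all
  moreover have "(\<lambda>y. P c k (y(4 := 0))) \<in> coord_polys"
    using P[OF ck] by (rule coord_polys_subst_0)
  moreover have "D y * P c k (y(4 := 0)) = 0" for y
  proof (cases "D y = 0")
    case False
    have "P c k (y(4 := 0)) = 0"
      using False ck
      by (intro generic_coefficients_0[where P = P and K = K, OF P rel]) (auto simp: D_def power_fun_apply)
    then show ?thesis by simp
  qed simp
  \<comment> \<open>Zeros at the coordinates of \<open>s22\<close> and \<open>s23\<close> remove the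
    subtracted terms, so every factor of \<open>D\<close> equals 1 here.\<close>
  moreover have "D (\<lambda>i. if i \<in> {5, 9} then 0 else 1) \<noteq> 0"
    by (simp add: D_def power_fun_apply)
  ultimately show ?thesis by (rule coord_polys_domain)
qed

section \<open>Coefficients in \<open>R_alg\<close> as polynomials in the generators\<close>

lemma length_R_generators: "length R_generators = 12"
  by (simp add: R_generators_def)

lemma R_generators_nth_in: "i < 12 \<Longrightarrow> R_generators ! i \<in> set R_generators"
  by (simp add: length_R_generators)

lemma coord_polys_gens_R_alg: "P \<in> coord_polys \<Longrightarrow> (\<lambda>x. P (gens x)) \<in> R_alg"
  unfolding coord_polys_def R_alg_def
proof (induction rule: generated_subalgebra.induct)
  case (gen f)
  then obtain i where i: "f = (\<lambda>y. y i)" "i < 12" by blast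
  have "(\<lambda>x. f (gens x)) = R_generators ! i" unfolding i gens_def ..
  then show ?case using R_generators_nth_in[OF i(2)] by (simp only: generated_subalgebra.gen)
next
  case (add f g)
  then show ?case using generated_subalgebra.add by (fastforce simp: plus_fun_def)
next
  case (mult f g)
  then show ?case using generated_subalgebra.mult by (fastforce simp: times_fun_def)
qed (rule generated_subalgebra.const)

lemma R_alg_coord_polys: "f \<in> R_alg \<Longrightarrow> \<exists>P\<in>coord_polys. f = (\<lambda>x. P (gens x))"
  unfolding coord_polys_def R_alg_def
proof (induction rule: generated_subalgebra.induct)
  case (const c)
  show ?case by (rule bexI[of _ "\<lambda>_. c"]) (rule refl, rule generated_subalgebra.const)
next
  case (gen f)
  then obtain i where i: "f = R_generators ! i" "i < length R_generators" by (metis in_set_conv_nth)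
  have "i < 12" using i(2) unfolding length_R_generators .
  show ?case
  proof
    show "f = (\<lambda>x. gens x i)" by (simp add: fun_eq_iff i(1) gens_def)
    show "(\<lambda>y. y i) \<in> generated_subalgebra {\<lambda>y. y i | i::nat. i < 12}"
      using coord_in_coord_polys[OF \<open>i < 12\<close>] unfolding coord_polys_def .
  qed
next
  case (add f g)
  then obtain P Q where "P \<in> coord_polys" "Q \<in> coord_polys" "f = (\<lambda>x. P (gens x))" "g = (\<lambda>x. Q (gens x))"
    unfolding coord_polys_def by blast
  moreover from this have "f + g = (\<lambda>x. (P + Q) (gens x))" by (simp add: fun_eq_iff)
  ultimately show ?case unfolding coord_polys_def using generated_subalgebra.add by blast
next
  case (mult f g)
  then obtain P Q where "P \<in> coord_polys" "Q \<in> coord_polys" "f = (\<lambda>x. P (gens x))" "g = (\<lambda>x. Q (gens x))"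
    unfolding coord_polys_def by blast
  moreover from this have "f * g = (\<lambda>x. (P * Q) (gens x))" by (simp add: fun_eq_iff)
  ultimately show ?case unfolding coord_polys_def using generated_subalgebra.mult by blast
qed

lemma E_elem_E_set: "c < 8 \<Longrightarrow> E_elem c k \<in> E_set"
proof -
  define a b where "a = s_fun [1,3]" and "b = s_fun [2,4]"
  \<comment> \<open>Exponents 0 and 1 are covered by the finite part of \<open>E_set\<close>, all
    others by its second part.\<close>
  have k: "k = 0 \<or> k = 1 \<or> k \<in> {2..}" by auto
  have k2: "k + 2 \<in> {2..}" by simp
  have "a ^ k \<in> E_set \<and> a ^ k * b \<in> E_set" using k unfolding E_set_def a_def b_def by fastforce
  moreover have "b ^ (k + 2) \<in> E_set \<and> b ^ (k + 2) * a \<in> E_set"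
    using k2 unfolding E_set_def a_def b_def by blast
  moreover have "a ^ k * s_fun [1,2,3] \<in> E_set \<and> a ^ k * s_fun [1,3,4] \<in> E_set
    \<and> b ^ k * s_fun [1,2,4] \<in> E_set \<and> b ^ k * s_fun [2,3,4] \<in> E_set"
    unfolding E_set_def a_def b_def by blast
  moreover assume "c < 8"
  ultimately show ?thesis
    unfolding less_8 E_elem_def a_def[symmetric] b_def[symmetric] by (elim insertE emptyE) simp_all
qed

lemma E_set_E_elem:
  assumes "e \<in> E_set" shows "\<exists>c<8. \<exists>k. e = E_elem c k"
proof -
  define a b where "a = s_fun [1,3]" and "b = s_fun [2,4]"
  have E: "\<exists>c<8. \<exists>k. e = E_elem c k" if "c < 8" "e = E_elem c k" for c k using that by blast
  consider "e \<in> {1, a, b, a * b}"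
    | k where "k \<ge> 2" "e \<in> {a ^ k, a ^ k * b, b ^ k, b ^ k * a}"
    | k where "e \<in> {a ^ k * s_fun [1,2,3], a ^ k * s_fun [1,3,4], b ^ k * s_fun [1,2,4], b ^ k * s_fun [2,3,4]}"
    using assms unfolding E_set_def a_def[symmetric] b_def[symmetric] by fast
  then show ?thesis
  proof cases
    case 1
    then show ?thesis using E(1)[of 0 0] E(1)[of 0 1] E(1)[of 1 0] E(1)[of 1 1]
      by (elim insertE emptyE) (simp_all add: E_elem_def a_def b_def)
  next
    case (2 k)
    then obtain j where "k = j + 2" by (metis le_add_diff_inverse2)
    with 2 show ?thesis using E(1)[of 0 k] E(1)[of 1 k] E(1)[of 2 j] E(1)[of 3 j]
      by (elim insertE emptyE) (simp_all add: E_elem_def a_def b_def)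
  next
    case (3 k)
    then show ?thesis using E(1)[of 4 k] E(1)[of 5 k] E(1)[of 6 k] E(1)[of 7 k]
      by (elim insertE emptyE) (simp_all add: E_elem_def a_def b_def)
  qed
qed

text \<open>Coefficients are kept as polynomials in twelve variables instead of elements of
  \<open>R_alg\<close>, so that setting \<open>y 4\<close> to zero and dividing by
  \<open>y 4\<close> make sense before the generators are known to be independent.\<close>

definition combination :: "nat \<Rightarrow> (nat \<Rightarrow> nat \<Rightarrow> (nat \<Rightarrow> complex) \<Rightarrow> complex) \<Rightarrow> mat2_tuple \<Rightarrow> complex" where
  "combination K P = (\<Sum>k<K. \<Sum>c<8. (\<lambda>x. P c k (gens x)) * E_elem c k)"

lemma combination_apply: "combination K P x = (\<Sum>k<K. \<Sum>c<8. P c k (gens x) * E_elem c k x)"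
  by (simp add: combination_def sum_fun_apply)

lemma T4_polynomial: "f \<in> T4 \<Longrightarrow> f \<in> polynomial_functions"
  by (simp add: T4_iff)

lemma combination_polynomial:
  assumes "\<And>c k. c < 8 \<Longrightarrow> k < K \<Longrightarrow> P c k \<in> coord_polys"
  shows "combination K P \<in> polynomial_functions"
  unfolding combination_def polynomial_functions_def
proof (intro generated_subalgebra_sum generated_subalgebra.mult; fold polynomial_functions_def)
  fix k c :: nat assume kc: "k \<in> {..<K}" "c \<in> {..<8}"
  show "E_elem c k \<in> polynomial_functions" using kc E_elem_E_set E_set_T4 T4_polynomial by blast
  have "(\<lambda>x. P c k (gens x)) \<in> R_alg" using kc by (intro coord_polys_gens_R_alg assms) auto
  then show "(\<lambda>x. P c k (gens x)) \<in> polynomial_functions" using R_alg_T4 T4_polynomial by blast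
qed

lemma gens_4: "gens x 4 = s_fun [1,1] x"
  by (simp add: gens_def R_generators_def)

lemma s_fun_11_nonzero: "\<exists>x. s_fun [1,1] x \<noteq> 0"
  by (intro exI[of _ "entries_tuple (\<lambda>_. 0) (\<lambda>_. 1) (\<lambda>_. 0) (\<lambda>_. 0)"]) (simp add: s_fun_2)

section \<open>Division by \<open>s_fun [1,1]\<close> and linear independence\<close>

text \<open>The combination vanishes where \<open>s_fun [1,1]\<close> does, so by
  \<open>coefficients_vanish\<close> each coefficient is zero for \<open>y 4 = 0\<close> and
  therefore a multiple of \<open>y 4\<close>. The common factor \<open>s_fun [1,1]\<close> is then
  cancelled.\<close>

lemma combination_divide:
  assumes P: "\<And>c k. c < 8 \<Longrightarrow> k < K \<Longrightarrow> P c k \<in> coord_polys"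
    and f: "f \<in> polynomial_functions" and eq: "\<And>x. combination K P x = s_fun [1,1] x * f x"
  obtains Q where "\<And>c k. c < 8 \<Longrightarrow> k < K \<Longrightarrow> Q c k \<in> coord_polys"
    and "\<And>c k y. c < 8 \<Longrightarrow> k < K \<Longrightarrow> P c k y = y 4 * Q c k y"
    and "combination K Q = f"
proof -
  have "\<exists>Q\<in>coord_polys. \<forall>y. P c k y = y 4 * Q y" if ck: "c < 8" "k < K" for c k
  proof -
    obtain Q where Q: "Q \<in> coord_polys" "\<And>y. P c k y = P c k (y(4 := 0)) + y 4 * Q y"
      using coord_polys_divide[OF P[OF ck]] by metis
    have "P c k (y(4 := 0)) = 0" for y
      using eq[unfolded combination_apply] ck
      by (intro coefficients_vanish[where P = P and K = K, OF P]) simp_all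
    then have "\<forall>y. P c k y = y 4 * Q y" using Q(2) by (metis add_0)
    then show ?thesis using Q(1) by blast
  qed
  then obtain Q where Q: "\<And>c k. c < 8 \<Longrightarrow> k < K \<Longrightarrow> Q c k \<in> coord_polys"
    "\<And>c k y. c < 8 \<Longrightarrow> k < K \<Longrightarrow> P c k y = y 4 * Q c k y" by metis
  obtain x0 where x0: "s_fun [1,1] x0 \<noteq> 0" using s_fun_11_nonzero by blast
  have "combination K Q = f"
  proof (rule polynomial_functions_cancel[where d = "s_fun [1,1]" and ?x0.0 = x0])
    show "f \<in> polynomial_functions" "s_fun [1,1] x0 \<noteq> 0" by fact+
    show "combination K Q \<in> polynomial_functions" using Q(1) by (rule combination_polynomial)
    show "s_fun [1,1] \<in> polynomial_functions" by (intro T4_polynomial s_fun_2_T4)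
    show "s_fun [1,1] x * combination K Q x = s_fun [1,1] x * f x" for x
      unfolding eq[symmetric] unfolding combination_apply sum_distrib_left
      by (intro sum.cong refl) (simp add: Q(2) gens_4)
  qed
  then show ?thesis using Q that by blast
qed

text \<open>Repeated division shows that each coefficient is divisible by every power of
  \<open>y 4\<close>. On a line in direction 4 it is a polynomial in one variable, which must be
  zero for reasons of degree.\<close>

lemma combination_eq_0:
  assumes P: "\<And>c k. c < 8 \<Longrightarrow> k < K \<Longrightarrow> P c k \<in> coord_polys"
    and eq: "combination K P = 0" and ck: "c < 8" "k < K"
  shows "P c k y = 0"
proof -
  have ex: "\<exists>Q. (\<forall>c k. c < 8 \<longrightarrow> k < K \<longrightarrow> Q c k \<in> coord_polys \<and> (\<forall>y. P c k y = y 4 ^ j * Q c k y))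
    \<and> combination K Q = 0" for j
  proof (induction j)
    case 0
    show ?case using P eq by (intro exI[of _ P]) auto
  next
    case (Suc j)
    then obtain Q where Q: "\<And>c k. c < 8 \<Longrightarrow> k < K \<Longrightarrow> Q c k \<in> coord_polys"
      "\<And>c k y. c < 8 \<Longrightarrow> k < K \<Longrightarrow> P c k y = y 4 ^ j * Q c k y" "combination K Q = 0" by blast
    show ?case
    proof (rule combination_divide[where P = Q and K = K and f = 0])
      show "Q c k \<in> coord_polys" if "c < 8" "k < K" for c k using Q(1) that .
      show "(0 :: mat2_tuple \<Rightarrow> complex) \<in> polynomial_functions"
        unfolding polynomial_functions_def by (rule generated_subalgebra_0)
      show "combination K Q x = s_fun [1,1] x * 0 x" for x using Q(3) by simp
    next
      fix Q'
      assume "\<And>c k. c < 8 \<Longrightarrow> k < K \<Longrightarrow> Q' c k \<in> coord_polys"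
        "\<And>c k y. c < 8 \<Longrightarrow> k < K \<Longrightarrow> Q c k y = y 4 * Q' c k y" "combination K Q' = 0"
      then show ?thesis using Q(2) by (intro exI[of _ Q']) simp
    qed
  qed
  define L where "L t = y(4 := t)" for t
  have line: "\<exists>p. \<forall>t. Q (L t) = poly p t" if "Q \<in> coord_polys" for Q
    using that unfolding coord_polys_def
  proof (rule generated_subalgebra_poly_line)
    fix g assume "g \<in> {\<lambda>y :: nat \<Rightarrow> complex. y i | i. i < 12}"
    then obtain i where g: "g = (\<lambda>y. y i)" by blast
    show "\<exists>p. \<forall>t::complex. g (L t) = poly p t"
      unfolding g L_def by (intro exI[of _ "if i = 4 then [:0,1:] else [:y i:]"]) simp
  qed
  obtain p where p: "\<And>t. P c k (L t) = poly p t" using line[OF P[OF ck]] by blast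
  have "p = 0"
  proof (rule ccontr)
    assume "p \<noteq> 0"
    define j where "j = Suc (degree p)"
    obtain Q where Q: "Q c k \<in> coord_polys" "\<And>y. P c k y = y 4 ^ j * Q c k y" using ex[of j] ck by blast
    obtain q where q: "\<And>t. Q c k (L t) = poly q t" using line[OF Q(1)] by blast
    have "poly p t = poly (monom 1 j * q) t" for t
      unfolding p[symmetric] Q(2) by (simp add: q poly_monom) (simp add: L_def)
    then have "p = monom 1 j * q" by (simp add: poly_eq_poly_eq_iff[symmetric] fun_eq_iff)
    moreover from this have "q \<noteq> 0" using \<open>p \<noteq> 0\<close> by auto
    ultimately have "degree p = j + degree q" by (simp add: degree_mult_eq degree_monom_eq)
    then show False by (simp add: j_def)
  qed
  then show ?thesis using p[of "y 4"] by (simp add: L_def)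
qed

lemma R_generators_independent: "algebraically_independent R_generators"
  unfolding algebraically_independent_def
proof (intro allI impI)
  fix p :: "(nat \<Rightarrow>\<^sub>0 nat) \<Rightarrow>\<^sub>0 complex"
  assume keys: "\<forall>m\<in>Poly_Mapping.keys p. Poly_Mapping.keys m \<subseteq> {..<length R_generators}"
    and p0: "poly_eval R_generators p = 0"
  note len = length_R_generators
  define P where "P = (\<Sum>m\<in>Poly_Mapping.keys p. (\<lambda>y. Poly_Mapping.lookup p m) *
    (\<Prod>i\<in>Poly_Mapping.keys m. (\<lambda>y::nat \<Rightarrow> complex. y i) ^ Poly_Mapping.lookup m i))"
  have P: "P \<in> coord_polys"
    unfolding P_def coord_polys_def
    using keys len
    by (intro generated_subalgebra_sum generated_subalgebra.mult generated_subalgebra.const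
        generated_subalgebra_prod generated_subalgebra_power coord_in_coord_polys[unfolded coord_polys_def]) auto
  have P_apply: "P y = (\<Sum>m\<in>Poly_Mapping.keys p. Poly_Mapping.lookup p m * monomial_fun m y)" for y
    unfolding P_def monomial_fun_def by (simp add: sum_fun_apply prod_fun_apply power_fun_apply)
  have "poly_eval R_generators p x = P (gens x)" for x
    unfolding P_def poly_eval_def by (simp add: sum_fun_apply prod_fun_apply power_fun_apply gens_def)
  then have P0: "P (gens x) = 0" for x using p0 by simp
  \<comment> \<open>A polynomial relation among the generators is a relation on the single basis
    element \<open>1 = E_elem 0 0\<close>; independence with polynomial coefficients thus contains
    algebraic independence.\<close>
  define Pf where "Pf c k = (if c = 0 then P else 0)" for c k :: nat
  have "combination 1 Pf = 0"
    by (rule ext) (simp add: combination_apply Pf_def sum_less_8 P0)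
  moreover have "Pf c k \<in> coord_polys" for c k
    using P generated_subalgebra_0 unfolding Pf_def coord_polys_def by auto
  ultimately have "P y = 0" for y using combination_eq_0[of 1 Pf 0 0 y] by (simp add: Pf_def)
  then show "p = 0" unfolding P_apply by (rule poly_mapping_eq_0_if_vanishing)
qed

text \<open>Each element of \<open>F\<close> is assigned an index pair and its coefficient a
  representing polynomial, by choice. Pairs outside the image receive 0, so the sum can be extended
  to the full rectangle of indices.\<close>

lemma sum_E_set_combination:
  assumes F: "finite F" "F \<subseteq> E_set" "\<forall>b\<in>F. cf b \<in> R_alg"
  obtains K P where "\<And>c k. P c k \<in> coord_polys" "(\<Sum>b\<in>F. cf b * b) = combination K P"
    "\<And>b. b \<in> F \<Longrightarrow> \<exists>c<8. \<exists>k<K. cf b = (\<lambda>x. P c k (gens x))"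
proof -
  have "\<forall>b\<in>F. \<exists>i. fst i < 8 \<and> E_elem (fst i) (snd i) = b"
  proof
    fix b assume "b \<in> F"
    then obtain c k where "c < 8" "b = E_elem c k" using E_set_E_elem F(2) by blast
    then show "\<exists>i. fst i < 8 \<and> E_elem (fst i) (snd i) = b" by (intro exI[of _ "(c, k)"]) simp
  qed
  from bchoice[OF this] obtain \<iota> where \<iota>: "\<And>b. b \<in> F \<Longrightarrow> fst (\<iota> b) < 8 \<and> E_elem (fst (\<iota> b)) (snd (\<iota> b)) = b"
    by blast
  have "\<forall>b\<in>F. \<exists>P. P \<in> coord_polys \<and> cf b = (\<lambda>x. P (gens x))" using F(3) R_alg_coord_polys by blast
  from bchoice[OF this] obtain rep where rep: "\<And>b. b \<in> F \<Longrightarrow> rep b \<in> coord_polys \<and> cf b = (\<lambda>x. rep b (gens x))"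
    by blast
  define K where "K = Suc (Max (insert 0 (snd ` \<iota> ` F)))"
  have K: "snd (\<iota> b) < K" if "b \<in> F" for b
    using F(1) that unfolding K_def by (intro le_imp_less_Suc Max_ge) auto
  define P where "P c k = (if (c, k) \<in> \<iota> ` F then rep (E_elem c k) else 0)" for c k
  have P_\<iota>: "P (fst (\<iota> b)) (snd (\<iota> b)) = rep b" if "b \<in> F" for b
    using \<iota>[OF that] that unfolding P_def by simp
  have 1: "P c k \<in> coord_polys" for c k
  proof (cases "(c, k) \<in> \<iota> ` F")
    case True
    then obtain b where b: "b \<in> F" "(c, k) = \<iota> b" by blast
    then have "P c k = rep b" using P_\<iota>[OF b(1)] by (simp flip: b(2))
    then show ?thesis using rep[OF b(1)] by simp
  next
    case False
    then show ?thesis using generated_subalgebra_0 unfolding P_def coord_polys_def by simp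
  qed
  have 2: "\<exists>c<8. \<exists>k<K. cf b = (\<lambda>x. P c k (gens x))" if "b \<in> F" for b
    using \<iota>[OF that] K[OF that] P_\<iota>[OF that] rep[OF that] by metis
  have inj: "inj_on \<iota> F" by (rule inj_onI) (metis \<iota>)
  have "(\<Sum>b\<in>F. cf b * b) = (\<Sum>i\<in>\<iota> ` F. (\<lambda>x. P (fst i) (snd i) (gens x)) * E_elem (fst i) (snd i))"
    unfolding sum.reindex[OF inj] comp_def using \<iota> rep P_\<iota> by (intro sum.cong refl) metis
  also have "\<dots> = (\<Sum>i\<in>{..<8} \<times> {..<K}. (\<lambda>x. P (fst i) (snd i) (gens x)) * E_elem (fst i) (snd i))"
  proof (rule sum.mono_neutral_left)
    show "\<iota> ` F \<subseteq> {..<8} \<times> {..<K}" using \<iota> K by (intro image_subsetI) (simp add: mem_Times_iff)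
    show "\<forall>i\<in>{..<8} \<times> {..<K} - \<iota> ` F. (\<lambda>x. P (fst i) (snd i) (gens x)) * E_elem (fst i) (snd i) = 0"
      by (auto simp: P_def fun_eq_iff)
  qed simp
  also have "\<dots> = (\<Sum>c<8. \<Sum>k<K. (\<lambda>x. P c k (gens x)) * E_elem c k)"
    unfolding sum.cartesian_product case_prod_beta ..
  also have "\<dots> = combination K P"
    unfolding combination_def by (rule sum.swap)
  finally have 3: "(\<Sum>b\<in>F. cf b * b) = combination K P" .
  from 1 3 2 show ?thesis by (rule that)
qed

lemma E_set_independent: "module_independent R_alg E_set"
  unfolding module_independent_def
proof (intro allI impI ballI)
  fix F cf b
  assume F: "finite F" "F \<subseteq> E_set" "\<forall>b\<in>F. cf b \<in> R_alg" "(\<Sum>b\<in>F. cf b * b) = 0" and b: "b \<in> F"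
  obtain K P where P: "\<And>c k. P c k \<in> coord_polys" "(\<Sum>b\<in>F. cf b * b) = combination K P"
    "\<And>b. b \<in> F \<Longrightarrow> \<exists>c<8. \<exists>k<K. cf b = (\<lambda>x. P c k (gens x))"
    by (rule sum_E_set_combination[OF F(1-3)]) blast
  obtain c k where "c < 8" "k < K" "cf b = (\<lambda>x. P c k (gens x))" using P(3)[OF b] by blast
  moreover have "P c k y = 0" if "c < 8" "k < K" for y
    using P(2) F(4) by (intro combination_eq_0[OF P(1) _ that]) simp
  ultimately show "cf b = 0" by (simp add: fun_eq_iff)
qed

section \<open>The module spanned by the basis\<close>

lemma module_span_add:
  assumes R0: "0 \<in> R" and Radd: "\<And>r s. r \<in> R \<Longrightarrow> s \<in> R \<Longrightarrow> r + s \<in> R"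
    and f: "f \<in> module_span R B" and g: "g \<in> module_span R B"
  shows "f + g \<in> module_span R B"
proof -
  obtain F c where F: "finite F" "F \<subseteq> B" "\<forall>b\<in>F. c b \<in> R" "f = (\<Sum>b\<in>F. c b * b)"
    using f unfolding module_span_def by blast
  obtain H d where H: "finite H" "H \<subseteq> B" "\<forall>b\<in>H. d b \<in> R" "g = (\<Sum>b\<in>H. d b * b)"
    using g unfolding module_span_def by blast
  define e where "e b = (if b \<in> F then c b else 0) + (if b \<in> H then d b else 0)" for b
  have "(\<Sum>b\<in>F \<union> H. e b * b)
    = (\<Sum>b\<in>F \<union> H. if b \<in> F then c b * b else 0) + (\<Sum>b\<in>F \<union> H. if b \<in> H then d b * b else 0)"
    unfolding sum.distrib[symmetric] e_def by (intro sum.cong refl) (simp add: distrib_right)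
  also have "\<dots> = f + g"
    unfolding F(4) H(4) using F(1) H(1) by (simp add: sum.If_cases Int_absorb1)
  finally have "f + g = (\<Sum>b\<in>F \<union> H. e b * b)" by (rule sym)
  moreover have "\<forall>b\<in>F \<union> H. e b \<in> R" using F(3) H(3) R0 Radd unfolding e_def by auto
  ultimately show ?thesis unfolding module_span_def using F(1,2) H(1,2) by blast
qed

lemma module_span_mult:
  assumes "\<And>s. s \<in> R \<Longrightarrow> r * s \<in> R" "f \<in> module_span R B"
  shows "r * f \<in> module_span R B"
proof -
  obtain F c where F: "finite F" "F \<subseteq> B" "\<forall>b\<in>F. c b \<in> R" "f = (\<Sum>b\<in>F. c b * b)"
    using assms(2) unfolding module_span_def by blast
  have "r * f = (\<Sum>b\<in>F. (r * c b) * b)" unfolding F(4) sum_distrib_left by (simp only: mult.assoc)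
  moreover have "\<forall>b\<in>F. r * c b \<in> R" using F(3) assms(1) by blast
  ultimately show ?thesis unfolding module_span_def using F(1,2) by (intro CollectI exI[of _ F] exI[of _ "\<lambda>b. r * c b"]) simp
qed

lemma module_span_base:
  assumes "1 \<in> R" "b \<in> B"
  shows "b \<in> module_span R B"
  unfolding module_span_def using assms by (intro CollectI exI[of _ "{b}"] exI[of _ "\<lambda>_. 1"]) simp

lemma module_span_0: "0 \<in> module_span R B"
  unfolding module_span_def by (intro CollectI exI[of _ "{}"]) simp

abbreviation "E_span \<equiv> module_span R_alg E_set"

lemmas R_alg_intros =
  generated_subalgebra_intros[where G = "set R_generators", folded R_alg_def]

lemma R_alg_gen: "f \<in> set R_generators \<Longrightarrow> f \<in> R_alg"
  unfolding R_alg_def by (rule generated_subalgebra.gen)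

lemma E_span_add: "f \<in> E_span \<Longrightarrow> g \<in> E_span \<Longrightarrow> f + g \<in> E_span"
  by (rule module_span_add) (auto intro: R_alg_intros)

lemma E_span_scale: "r \<in> R_alg \<Longrightarrow> f \<in> E_span \<Longrightarrow> r * f \<in> E_span"
  by (rule module_span_mult) (auto intro: R_alg_intros)

lemma E_span_uminus: "f \<in> E_span \<Longrightarrow> - f \<in> E_span"
  using E_span_scale[of "- 1" f] R_alg_intros(5,6) by simp

lemma E_span_diff: "f \<in> E_span \<Longrightarrow> g \<in> E_span \<Longrightarrow> f - g \<in> E_span"
  using E_span_add[OF _ E_span_uminus, of f g] by simp

lemma E_span_base: "b \<in> E_set \<Longrightarrow> b \<in> E_span"
  by (rule module_span_base) (rule R_alg_intros)

lemma E_span_mult_closed: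
  assumes "\<And>e. e \<in> E_set \<Longrightarrow> f * e \<in> E_span" and "g \<in> E_span"
  shows "f * g \<in> E_span"
proof -
  obtain F c where F: "finite F" "F \<subseteq> E_set" "\<forall>b\<in>F. c b \<in> R_alg" "g = (\<Sum>b\<in>F. c b * b)"
    using assms(2) unfolding module_span_def by blast
  have "f * (\<Sum>b\<in>F. c b * b) \<in> E_span"
    using F(1-3)
  proof (induction F rule: finite_induct)
    case empty
    show ?case unfolding sum.empty mult_zero_right by (rule module_span_0)
  next
    case (insert b F)
    have "f * (\<Sum>b\<in>F. c b * b) \<in> E_span" using insert.IH insert.prems by blast
    moreover have "c b * (f * b) \<in> E_span" using insert.prems by (intro E_span_scale assms(1)) auto
    ultimately have "c b * (f * b) + f * (\<Sum>b\<in>F. c b * b) \<in> E_span" by (rule E_span_add[rotated])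
    then show ?case unfolding sum.insert[OF insert.hyps] by (simp only: distrib_left mult.left_commute)
  qed
  then show ?thesis unfolding F(4) .
qed

lemma s_in_R_alg:
  "s_fun [1,1] \<in> R_alg" "s_fun [2,2] \<in> R_alg" "s_fun [3,3] \<in> R_alg" "s_fun [4,4] \<in> R_alg"
  "s_fun [1,2] \<in> R_alg" "s_fun [2,3] \<in> R_alg" "s_fun [3,4] \<in> R_alg" "s_fun [1,4] \<in> R_alg"
  "s_fun [2,1] \<in> R_alg" "s_fun [3,2] \<in> R_alg" "s_fun [4,3] \<in> R_alg" "s_fun [4,1] \<in> R_alg"
  by (simp_all add: R_alg_gen R_generators_def s_fun_2_commute[of 2 1] s_fun_2_commute[of 3 2]
      s_fun_2_commute[of 4 3] s_fun_2_commute[of 4 1])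

lemma t_in_R_alg: "t_fun [i] \<in> R_alg"
  using exhaust_4[of i] by (auto simp: R_alg_gen R_generators_def)

text \<open>The Gram determinant of four vectors in a three-dimensional space vanishes.\<close>

lemma gram_relation:
  obtains u v w c d e where "u \<in> R_alg" "v \<in> R_alg" "w \<in> R_alg" "c \<in> R_alg" "d \<in> R_alg" "e \<in> R_alg"
    "s_fun [1,3] ^ 2 * s_fun [2,4] ^ 2 = u * s_fun [1,3] ^ 2 + v * s_fun [2,4] ^ 2
      + w * (s_fun [1,3] * s_fun [2,4]) + c * s_fun [1,3] + d * s_fun [2,4] + e"
proof -
  define a b where "a = s_fun [1,3]" and "b = s_fun [2,4]"
  define s11 s22 s33 s44 s12 s23 s34 s14 where "s11 = s_fun [1,1]" and "s22 = s_fun [2,2]" and "s33 = s_fun [3,3]"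
    and "s44 = s_fun [4,4]" and "s12 = s_fun [1,2]" and "s23 = s_fun [2,3]" and "s34 = s_fun [3,4]" and "s14 = s_fun [1,4]"
  note defs = a_def b_def s11_def s22_def s33_def s44_def s12_def s23_def s34_def s14_def
  have comm: "s_fun [2,1] = s12" "s_fun [3,1] = a" "s_fun [4,1] = s14" "s_fun [3,2] = s23" "s_fun [4,2] = b" "s_fun [4,3] = s34"
    by (simp_all only: defs s_fun_2_commute[of 2 1] s_fun_2_commute[of 3 1] s_fun_2_commute[of 4 1]
      s_fun_2_commute[of 3 2] s_fun_2_commute[of 4 2] s_fun_2_commute[of 4 3])
  have R: "s11 \<in> R_alg" "s22 \<in> R_alg" "s33 \<in> R_alg" "s44 \<in> R_alg" "s12 \<in> R_alg" "s23 \<in> R_alg" "s34 \<in> R_alg" "s14 \<in> R_alg"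
    unfolding defs by (rule s_in_R_alg)+
  have D: "- 2 * (s_fun [2,3,4] x * s_fun [i,j,k] x) =
      s_fun [2, i] x * (s_fun [3, j] x * s_fun [4, k] x - s_fun [3, k] x * s_fun [4, j] x)
    - s_fun [2, j] x * (s_fun [3, i] x * s_fun [4, k] x - s_fun [3, k] x * s_fun [4, i] x)
    + s_fun [2, k] x * (s_fun [3, i] x * s_fun [4, j] x - s_fun [3, j] x * s_fun [4, i] x)"
    (is "_ = ?Y") for i j k x
  proof -
    have "s_fun [2,3,4] x * s_fun [i,j,k] x = - 1 / 2 * ?Y"
      using fun_cong[OF s_fun_3_mult, of 2 3 4 i j k x] by (simp only: times_fun_apply plus_fun_apply minus_apply)
    then show ?thesis by (simp only: mult.assoc[symmetric]) simp
  qed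
  have "a ^ 2 * b ^ 2 = (s22 * s44) * a ^ 2 + (s11 * s33) * b ^ 2
      + (2 * (s12 * s34 + s14 * s23)) * (a * b) + - (2 * (s12 * s23 * s44 + s14 * s22 * s34)) * a
      + - (2 * (s11 * s23 * s34 + s12 * s14 * s33)) * b
      + (s11 * s22 * s34 ^ 2 + s11 * s23 ^ 2 * s44 + s12 ^ 2 * s33 * s44 + 2 * (s12 * s14 * s23 * s34)
         + s14 ^ 2 * s22 * s33 - s11 * s22 * s33 * s44 - s12 ^ 2 * s34 ^ 2 - s14 ^ 2 * s23 ^ 2)" (is "_ = ?r")
  proof
    fix x
    \<comment> \<open>The Plucker relation for index 1, multiplied by
      \<open>- 2 * s_fun [2,3,4]\<close>. The product formula \<open>D\<close> makes it the
      expansion of the Gram determinant along its first row.\<close>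
    have "- 2 * s_fun [2,3,4] x * (s_fun [2, 3, 4] * s_fun [1, 1] - s_fun [1, 3, 4] * s_fun [2, 1]
      + s_fun [1, 2, 4] * s_fun [3, 1] - s_fun [1, 2, 3] * s_fun [4, 1]) x = 0"
      unfolding s_fun_plucker by simp
    moreover note D[where i = 2 and j = 3 and k = 4 and x = x] D[where i = 1 and j = 3 and k = 4 and x = x] D[where i = 1 and j = 2 and k = 4 and x = x] D[where i = 1 and j = 2 and k = 3 and x = x]
    ultimately show "(a ^ 2 * b ^ 2) x = ?r x"
      unfolding comm defs[symmetric]
      by (simp add: power_fun_apply) algebra
  qed
  moreover have "2 \<in> R_alg" using R_alg_intros(2)[OF R_alg_intros(5) R_alg_intros(5)] by simp
  ultimately show ?thesis
    unfolding a_def[symmetric] b_def[symmetric] using R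
    by (intro that[unfolded a_def[symmetric] b_def[symmetric], of "s22 * s44" "s11 * s33"
          "2 * (s12 * s34 + s14 * s23)" "- (2 * (s12 * s23 * s44 + s14 * s22 * s34))"
          "- (2 * (s11 * s23 * s34 + s12 * s14 * s33))"
          "s11 * s22 * s34 ^ 2 + s11 * s23 ^ 2 * s44 + s12 ^ 2 * s33 * s44 + 2 * (s12 * s14 * s23 * s34)
           + s14 ^ 2 * s22 * s33 - s11 * s22 * s33 * s44 - s12 ^ 2 * s34 ^ 2 - s14 ^ 2 * s23 ^ 2"])
      (assumption | rule R_alg_intros(2,3,6,7,8))+
qed

section \<open>Reduction of monomials to the basis\<close>

lemma E_elem_E_span: "c < 8 \<Longrightarrow> E_elem c k \<in> E_span"
  by (rule E_span_base[OF E_elem_E_set])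

lemma low_monomials_E_span:
  "s_fun [1,3] ^ k \<in> E_span" "s_fun [1,3] ^ k * s_fun [2,4] \<in> E_span"
  "s_fun [2,4] ^ k \<in> E_span" "s_fun [1,3] * s_fun [2,4] ^ k \<in> E_span"
proof -
  show 1: "s_fun [1,3] ^ k \<in> E_span" and 2: "s_fun [1,3] ^ k * s_fun [2,4] \<in> E_span" for k
    using E_elem_E_span[of 0 k] E_elem_E_span[of 1 k] unfolding E_elem_def by simp_all
  consider "k = 0" | "k = 1" | j where "k = j + 2" by (metis One_nat_def add_2_eq_Suc' not0_implies_Suc)
  then have "s_fun [2,4] ^ k \<in> E_span \<and> s_fun [1,3] * s_fun [2,4] ^ k \<in> E_span"
  proof cases
    case (3 j)
    show ?thesis using E_elem_E_span[of 2 j] E_elem_E_span[of 3 j] unfolding E_elem_def 3 by (simp add: mult.commute)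
  qed (use 1[of 0] 2[of 0] 1[of 1] 2[of 1] in simp_all)
  then show "s_fun [2,4] ^ k \<in> E_span" "s_fun [1,3] * s_fun [2,4] ^ k \<in> E_span" by blast+
qed

text \<open>Monomials with \<open>i \<le> 1\<close> or \<open>j \<le> 1\<close> belong to
  \<open>E_set\<close>. In all others a factor \<open>a^2 * b^2\<close> is replaced by means of the
  Gram relation, and every resulting monomial has smaller total degree.\<close>

lemma even_monomials_E_span: "s_fun [1,3] ^ i * s_fun [2,4] ^ j \<in> E_span"
proof (induction "i + j" arbitrary: i j rule: less_induct)
  case less
  define a b where "a = s_fun [1,3]" and "b = s_fun [2,4]"
  consider "i = 0" | "i = 1" | "j = 0" | "j = 1" | i' j' where "i = i' + 2" "j = j' + 2"
    by (metis One_nat_def add_2_eq_Suc' not0_implies_Suc)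
  then show ?case
  proof cases
    case (5 i' j')
    obtain u v w c d e where R: "u \<in> R_alg" "v \<in> R_alg" "w \<in> R_alg" "c \<in> R_alg" "d \<in> R_alg" "e \<in> R_alg"
      and eq: "a ^ 2 * b ^ 2 = u * a ^ 2 + v * b ^ 2 + w * (a * b) + c * a + d * b + e"
      unfolding a_def b_def by (rule gram_relation)
    have RM: "r * (a ^ p * b ^ q) \<in> E_span" if "r \<in> R_alg" "p + q < i + j" for r p q
      unfolding a_def b_def using that(1) less[OF that(2)] by (rule E_span_scale)
    have "a ^ i * b ^ j = (a ^ i' * b ^ j') * (a ^ 2 * b ^ 2)" unfolding 5 power_add by (simp only: mult_ac)
    also have "\<dots> = u * (a ^ (i' + 2) * b ^ j') + v * (a ^ i' * b ^ (j' + 2)) + w * (a ^ (i' + 1) * b ^ (j' + 1))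
        + c * (a ^ (i' + 1) * b ^ j') + d * (a ^ i' * b ^ (j' + 1)) + e * (a ^ i' * b ^ j')"
      unfolding eq power_add power_one_right by (simp only: distrib_left mult_ac)
    also have "\<dots> \<in> E_span"
      by (intro E_span_add RM R) (simp_all add: 5)
    finally show ?thesis unfolding a_def b_def .
  qed (use low_monomials_E_span in simp_all)
qed

text \<open>The linear relations paired with 2 and 4 rewrite \<open>b * s123\<close> and
  \<open>b * s134\<close>, those paired with 1 and 3 rewrite \<open>a * s124\<close> and
  \<open>a * s234\<close>. Each use lowers \<open>i + j\<close> by one, and the monomials to which
  none applies are in \<open>E_set\<close>.\<close>

lemma odd_monomials_E_span:
  "s_fun [1,3] ^ i * s_fun [2,4] ^ j * s_fun [1,2,3] \<in> E_span \<and> s_fun [1,3] ^ i * s_fun [2,4] ^ j * s_fun [1,2,4] \<in> E_span \<and>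
   s_fun [1,3] ^ i * s_fun [2,4] ^ j * s_fun [1,3,4] \<in> E_span \<and> s_fun [1,3] ^ i * s_fun [2,4] ^ j * s_fun [2,3,4] \<in> E_span"
proof (induction "i + j" arbitrary: i j rule: less_induct)
  case less
  define a b where "a = s_fun [1,3]" and "b = s_fun [2,4]"
  define M where "M i j = a ^ i * b ^ j" for i j
  have comm: "s_fun [3,1] = a" "s_fun [4,2] = b"
    by (simp_all only: a_def b_def s_fun_2_commute[of 3 1] s_fun_2_commute[of 4 2])
  have b123: "b * s_fun [1,2,3] = s_fun [1,2] * s_fun [2,3,4] + - s_fun [2,2] * s_fun [1,3,4] + s_fun [3,2] * s_fun [1,2,4]"
    using s_fun_plucker[of 2] unfolding comm by (simp add: algebra_simps)
  have b134: "b * s_fun [1,3,4] = s_fun [1,4] * s_fun [2,3,4] + s_fun [3,4] * s_fun [1,2,4] + - s_fun [4,4] * s_fun [1,2,3]"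
    using s_fun_plucker[of 4] unfolding b_def[symmetric] by (simp add: algebra_simps)
  have a124: "a * s_fun [1,2,4] = s_fun [2,1] * s_fun [1,3,4] + s_fun [4,1] * s_fun [1,2,3] + - s_fun [1,1] * s_fun [2,3,4]"
    using s_fun_plucker[of 1] unfolding comm by (simp add: algebra_simps)
  have a234: "a * s_fun [2,3,4] = s_fun [2,3] * s_fun [1,3,4] + - s_fun [3,3] * s_fun [1,2,4] + s_fun [4,3] * s_fun [1,2,3]"
    using s_fun_plucker[of 3] unfolding a_def[symmetric] by (simp add: algebra_simps)
  have IH: "M i' j' * s_fun [1,2,3] \<in> E_span" "M i' j' * s_fun [1,2,4] \<in> E_span" "M i' j' * s_fun [1,3,4] \<in> E_span" "M i' j' * s_fun [2,3,4] \<in> E_span"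
    if "i' + j' < i + j" for i' j'
    using less[OF that] unfolding M_def a_def b_def by blast+
  have base: "M i 0 * s_fun [1,2,3] \<in> E_span" "M i 0 * s_fun [1,3,4] \<in> E_span" "M 0 j * s_fun [1,2,4] \<in> E_span" "M 0 j * s_fun [2,3,4] \<in> E_span"
    using E_elem_E_span[of 4 i] E_elem_E_span[of 5 i] E_elem_E_span[of 6 j] E_elem_E_span[of 7 j]
    unfolding E_elem_def M_def a_def b_def by simp_all
  have comb: "M i' j' * (r1 * f1 + r2 * f2 + r3 * f3) \<in> E_span"
    if "r1 \<in> R_alg" "r2 \<in> R_alg" "r3 \<in> R_alg" "M i' j' * f1 \<in> E_span" "M i' j' * f2 \<in> E_span" "M i' j' * f3 \<in> E_span"
    for i' j' r1 r2 r3 f1 f2 f3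
  proof -
    have "M i' j' * (r1 * f1 + r2 * f2 + r3 * f3) = r1 * (M i' j' * f1) + r2 * (M i' j' * f2) + r3 * (M i' j' * f3)"
      by (simp only: distrib_left mult_ac)
    also have "\<dots> \<in> E_span" by (intro E_span_add; rule E_span_scale; fact)
    finally show ?thesis .
  qed
  have stepb: "M i j * f = M i j' * (b * f)" if "j = Suc j'" for f j' unfolding M_def that by (simp only: power_Suc mult_ac)
  have stepa: "M i j * f = M i' j * (a * f)" if "i = Suc i'" for f i' unfolding M_def that by (simp only: power_Suc mult_ac)
  have "M i j * s_fun [1,2,3] \<in> E_span \<and> M i j * s_fun [1,3,4] \<in> E_span"
  proof (cases j)
    case (Suc j')
    show ?thesis unfolding stepb[OF Suc] b123 b134
      by (intro conjI comb IH R_alg_intros(6) s_in_R_alg) (use Suc in simp_all)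
  qed (use base in simp)
  moreover have "M i j * s_fun [1,2,4] \<in> E_span \<and> M i j * s_fun [2,3,4] \<in> E_span"
  proof (cases i)
    case (Suc i')
    show ?thesis unfolding stepa[OF Suc] a124 a234
      by (intro conjI comb IH R_alg_intros(6) s_in_R_alg) (use Suc in simp_all)
  qed (use base in simp)
  ultimately show ?case unfolding M_def a_def b_def by blast
qed

definition odd_elements :: "(mat2_tuple \<Rightarrow> complex) set" where
  "odd_elements = {s_fun [1,2,3], s_fun [1,2,4], s_fun [1,3,4], s_fun [2,3,4]}"

lemma odd_monomial_E_span: "s \<in> odd_elements \<Longrightarrow> s_fun [1,3] ^ i * s_fun [2,4] ^ j * s \<in> E_span"
  using odd_monomials_E_span[of i j] unfolding odd_elements_def by blast

lemma E_set_cases: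
  assumes "e \<in> E_set"
  obtains i j where "e = s_fun [1,3] ^ i * s_fun [2,4] ^ j"
  | i j s where "s \<in> odd_elements" "e = s_fun [1,3] ^ i * s_fun [2,4] ^ j * s"
proof -
  define a b where "a = s_fun [1,3]" and "b = s_fun [2,4]"
  obtain c k where c: "c < 8" and e: "e = E_elem c k" using E_set_E_elem[OF assms] by blast
  have "(\<exists>i j. e = a ^ i * b ^ j) \<or> (\<exists>i j. \<exists>s\<in>odd_elements. e = a ^ i * b ^ j * s)"
  proof -
    have even: ?thesis if "e = a ^ i * b ^ j" for i j using that by blast
    have odd: ?thesis if "s \<in> odd_elements" "e = a ^ i * b ^ j * s" for i j s using that by blast
    have o: "s_fun [1,2,3] \<in> odd_elements" "s_fun [1,2,4] \<in> odd_elements" "s_fun [1,3,4] \<in> odd_elements" "s_fun [2,3,4] \<in> odd_elements"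
      by (simp_all add: odd_elements_def)
    consider "c = 0" | "c = 1" | "c = 2" | "c = 3" | "c = 4" | "c = 5" | "c = 6" | "c = 7" using c by linarith
    then show ?thesis
    proof cases
      case 1 then show ?thesis by (intro even[of k 0]) (simp add: e E_elem_def a_def)
    next
      case 2 then show ?thesis by (intro even[of k 1]) (simp add: e E_elem_def a_def b_def)
    next
      case 3 then show ?thesis by (intro even[of 0 "k + 2"]) (simp add: e E_elem_def b_def)
    next
      case 4 then show ?thesis by (intro even[of 1 "k + 2"]) (simp add: e E_elem_def a_def b_def mult_ac)
    next
      case 5 then show ?thesis by (intro odd[OF o(1), of k 0]) (simp add: e E_elem_def a_def)
    next
      case 6 then show ?thesis by (intro odd[OF o(3), of k 0]) (simp add: e E_elem_def a_def)
    next
      case 7 then show ?thesis by (intro odd[OF o(2), of 0 k]) (simp add: e E_elem_def b_def)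
    next
      case 8 then show ?thesis by (intro odd[OF o(4), of 0 k]) (simp add: e E_elem_def b_def)
    qed
  qed
  then show ?thesis using that unfolding a_def b_def by blast
qed

section \<open>Closure of the span under multiplication by trace functions\<close>

text \<open>Closure under sums and products is immediate for this set, and it lies in
  \<open>E_span\<close> because \<open>1 \<in> E_span\<close>. To place an algebra inside the span
  it therefore suffices that its generators are multipliers.\<close>

definition E_span_multipliers :: "(mat2_tuple \<Rightarrow> complex) set" where
  "E_span_multipliers = {f. \<forall>g\<in>E_span. f * g \<in> E_span}"

lemma E_span_multipliersI: "(\<And>e. e \<in> E_set \<Longrightarrow> f * e \<in> E_span) \<Longrightarrow> f \<in> E_span_multipliers"
  unfolding E_span_multipliers_def using E_span_mult_closed by blast

lemma E_span_multipliers_add: "f \<in> E_span_multipliers \<Longrightarrow> g \<in> E_span_multipliers \<Longrightarrow> f + g \<in> E_span_multipliers"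
  unfolding E_span_multipliers_def mem_Collect_eq distrib_right by (blast intro: E_span_add)

lemma E_span_multipliers_diff: "f \<in> E_span_multipliers \<Longrightarrow> g \<in> E_span_multipliers \<Longrightarrow> f - g \<in> E_span_multipliers"
  unfolding E_span_multipliers_def mem_Collect_eq left_diff_distrib by (blast intro: E_span_diff)

lemma E_span_multipliers_uminus: "f \<in> E_span_multipliers \<Longrightarrow> - f \<in> E_span_multipliers"
  unfolding E_span_multipliers_def mem_Collect_eq mult_minus_left by (blast intro: E_span_uminus)

lemma E_span_multipliers_mult: "f \<in> E_span_multipliers \<Longrightarrow> g \<in> E_span_multipliers \<Longrightarrow> f * g \<in> E_span_multipliers"
  unfolding E_span_multipliers_def mem_Collect_eq mult.assoc by blast

lemma R_alg_multipliers: "f \<in> R_alg \<Longrightarrow> f \<in> E_span_multipliers"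
  unfolding E_span_multipliers_def by (blast intro: E_span_scale)

lemma E_span_multipliers_power: "f \<in> E_span_multipliers \<Longrightarrow> f ^ k \<in> E_span_multipliers"
  by (induction k) (simp_all only: power_0 power_Suc E_span_multipliers_mult R_alg_multipliers R_alg_intros(5))

lemma one_E_span: "1 \<in> E_span"
  using low_monomials_E_span(1)[of 0] by simp

lemma E_span_multipliers_subset_E_span: "f \<in> E_span_multipliers \<Longrightarrow> f \<in> E_span"
  unfolding E_span_multipliers_def using one_E_span by (metis (mono_tags, lifting) mem_Collect_eq mult.right_neutral)

lemma s13_s24_multipliers: "s_fun [1,3] \<in> E_span_multipliers" "s_fun [2,4] \<in> E_span_multipliers"
proof -
  define a b where "a = s_fun [1,3]" and "b = s_fun [2,4]"
  have mono: "a ^ i * b ^ j \<in> E_span" "s \<in> odd_elements \<Longrightarrow> a ^ i * b ^ j * s \<in> E_span" for i j s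
    unfolding a_def b_def using even_monomials_E_span odd_monomial_E_span by blast+
  have a: "a * (a ^ i * b ^ j) = a ^ Suc i * b ^ j" "a * (a ^ i * b ^ j * s) = a ^ Suc i * b ^ j * s"
    and b: "b * (a ^ i * b ^ j) = a ^ i * b ^ Suc j" "b * (a ^ i * b ^ j * s) = a ^ i * b ^ Suc j * s" for i j s
    by (simp_all only: power_Suc mult_ac)
  have "a * e \<in> E_span \<and> b * e \<in> E_span" if "e \<in> E_set" for e
    using that
  proof (cases rule: E_set_cases)
    case (1 i j)
    then show ?thesis unfolding 1[folded a_def b_def] a b by (intro conjI mono)
  next
    case (2 i j s)
    then show ?thesis unfolding 2(2)[folded a_def b_def] a b by (intro conjI mono)
  qed
  then show "s_fun [1,3] \<in> E_span_multipliers" "s_fun [2,4] \<in> E_span_multipliers"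
    unfolding a_def b_def by (intro E_span_multipliersI; blast)+
qed

lemma s_fun_2_multipliers: "s_fun [i, j] \<in> E_span_multipliers"
  using exhaust_4[of i] exhaust_4[of j] s_in_R_alg[THEN R_alg_multipliers] s13_s24_multipliers
    s_fun_2_commute[of 1 3] s_fun_2_commute[of 2 4]
  by (elim disjE) simp_all

text \<open>On even basis elements this is \<open>odd_monomial_E_span\<close>. On odd ones, the
  product of two odd elements is by \<open>s_fun_3_mult\<close> a polynomial in the
  \<open>s_ij\<close>, which are multipliers already.\<close>

lemma odd_multipliers: "s \<in> odd_elements \<Longrightarrow> s \<in> E_span_multipliers"
proof (rule E_span_multipliersI)
  fix e assume s: "s \<in> odd_elements" and "e \<in> E_set"
  have half: "(\<lambda>_. - 1 / 2) \<in> E_span_multipliers" by (intro R_alg_multipliers R_alg_intros(1))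
  have prod: "s_fun [i, j, k] * s_fun [l, m, n] \<in> E_span_multipliers" for i j k l m n
    unfolding s_fun_3_mult
    by (intro E_span_multipliers_mult E_span_multipliers_add E_span_multipliers_diff half s_fun_2_multipliers)
  have M: "s_fun [1,3] ^ i * s_fun [2,4] ^ j \<in> E_span_multipliers" for i j
    by (intro E_span_multipliers_mult E_span_multipliers_power s13_s24_multipliers)
  show "s * e \<in> E_span"
    using \<open>e \<in> E_set\<close>
  proof (cases rule: E_set_cases)
    case (1 i j)
    show ?thesis unfolding 1 using odd_monomial_E_span[OF s, of i j] by (simp only: mult.commute)
  next
    case (2 i j s')
    have "s * s' \<in> E_span_multipliers"
      using s 2(1) prod unfolding odd_elements_def by (elim insertE emptyE) simp_all
    then have "(s_fun [1,3] ^ i * s_fun [2,4] ^ j) * (s * s') \<in> E_span"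
      by (intro E_span_multipliers_subset_E_span E_span_multipliers_mult[OF M])
    then show ?thesis unfolding 2(2) by (simp only: mult_ac)
  qed
qed

lemma s_fun_3_multipliers: "s_fun [1, i, j] \<in> E_span_multipliers"
proof -
  have o: "s_fun [1,2,3] \<in> E_span_multipliers" "s_fun [1,2,4] \<in> E_span_multipliers" "s_fun [1,3,4] \<in> E_span_multipliers"
    by (simp_all add: odd_multipliers odd_elements_def)
  have 0: "0 \<in> E_span_multipliers" by (intro R_alg_multipliers R_alg_intros(4))
  have sw: "s_fun [1, j, i] = - s_fun [1, i, j]" for i j
    using s_fun_3_rotate[of j i 1] s_fun_3_rotate[of 1 j i] s_fun_3_swap[of j i 1] s_fun_3_rotate[of 1 i j] by simp
  show ?thesis
    using exhaust_4[of i] exhaust_4[of j] o o[THEN E_span_multipliers_uminus] 0 sw[of 3 2] sw[of 4 2] sw[of 4 3]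
    by (elim disjE) (simp_all add: s_fun_3_refl)
qed

text \<open>These are the invariants that appear when torus invariants are rewritten on the slice
  with diagonal first matrix; this is why the words of length three start with 1.\<close>

definition trace_alg :: "(mat2_tuple \<Rightarrow> complex) set" where
  "trace_alg = generated_subalgebra ({t_fun [i] | i. True} \<union> {s_fun [i, j] | i j. True} \<union> {s_fun [1, i, j] | i j. True})"

lemma trace_alg_gens: "t_fun [i] \<in> trace_alg" "s_fun [i, j] \<in> trace_alg" "s_fun [1, i, j] \<in> trace_alg"
  unfolding trace_alg_def by (rule generated_subalgebra.gen; blast)+

lemma trace_alg_E_span: "f \<in> trace_alg \<Longrightarrow> f \<in> E_span"
proof (rule E_span_multipliers_subset_E_span)
  assume "f \<in> trace_alg"
  then show "f \<in> E_span_multipliers"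
    unfolding trace_alg_def
  proof induction
    case (const c)
    show ?case by (intro R_alg_multipliers R_alg_intros(1))
  next
    case (gen f)
    then show ?case using t_in_R_alg[THEN R_alg_multipliers] s_fun_2_multipliers s_fun_3_multipliers by blast
  next
    case (add f g)
    show ?case using add.IH by (rule E_span_multipliers_add)
  next
    case (mult f g)
    show ?case using mult.IH by (rule E_span_multipliers_mult)
  qed
qed

lemma trace_alg_T4: "f \<in> trace_alg \<Longrightarrow> f \<in> T4"
  unfolding trace_alg_def
  by (rule generated_subalgebra_T4[rotated]) (auto simp: t_fun_T4 s_fun_2_T4 s_fun_3_T4)

section \<open>Torus invariants\<close>

lemma conj_tuple_eqI:
  fixes g :: mat2
  assumes g: "invertible g" and "\<And>i. g ** x $ i = x' $ i ** g"
  shows "conj_tuple g x = x'"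
proof -
  have "g ** x $ i ** matrix_inv g = x' $ i" for i
    unfolding assms(2) using g by (simp add: matrix_mul_assoc[symmetric] matrix_inv_cancel)
  then show ?thesis by (simp add: conj_tuple_def vec_eq_iff)
qed

definition mat22 :: "complex \<Rightarrow> complex \<Rightarrow> complex \<Rightarrow> complex \<Rightarrow> mat2" where
  "mat22 a b c d = (\<chi> i j. if i = 1 then (if j = 1 then a else b) else (if j = 1 then c else d))"

lemma mat22_entries [simp]:
  "mat22 a b c d $ 1 $ 1 = a" "mat22 a b c d $ 1 $ 2 = b" "mat22 a b c d $ 2 $ 1 = c" "mat22 a b c d $ 2 $ 2 = d"
  by (simp_all add: mat22_def)

lemma invertible_mat22: "invertible (mat22 a b c d) \<longleftrightarrow> a * d - b * c \<noteq> 0"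
  by (simp add: invertible_det_nz det_2)

text \<open>The transformed tuple is the conjugate by the diagonal matrix with entries
  \<open>z\<close> and 1.\<close>

lemma T4_torus:
  assumes f: "f \<in> T4" and z: "z \<noteq> 0"
  shows "f (\<chi> i. mat22 (x $ i $ 1 $ 1) (z * x $ i $ 1 $ 2) (x $ i $ 2 $ 1 / z) (x $ i $ 2 $ 2)) = f x"
proof -
  have g: "invertible (mat22 z 0 0 1)" using z by (simp add: invertible_mat22)
  have "conj_tuple (mat22 z 0 0 1) x
    = (\<chi> i. mat22 (x $ i $ 1 $ 1) (z * x $ i $ 1 $ 2) (x $ i $ 2 $ 1 / z) (x $ i $ 2 $ 2))"
    using z by (intro conj_tuple_eqI g) (simp add: vec_eq_iff forall_2 matrix_matrix_mult_def sum_2)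
  then show ?thesis using f g unfolding T4_iff by metis
qed

text \<open>The polynomial functions of weight zero, where upper right entries have weight 1, lower
  left entries weight -1 and diagonal entries weight 0.\<close>

definition torus_alg :: "(mat2_tuple \<Rightarrow> complex) set" where
  "torus_alg = generated_subalgebra ({\<lambda>x. x $ i $ 1 $ 1 | i. True} \<union> {\<lambda>x. x $ i $ 2 $ 2 | i. True}
    \<union> {\<lambda>x. x $ i $ 1 $ 2 * x $ j $ 2 $ 1 | i j. True})"

text \<open>The components are a factor meant to have weight zero, the indices of the upper right
  entries and those of the lower left entries. The weight is the difference of the two
  lengths.\<close>

type_synonym torus_monomial = "(mat2_tuple \<Rightarrow> complex) \<times> 4 list \<times> 4 list"

definition torus_monomial :: "torus_monomial \<Rightarrow> mat2_tuple \<Rightarrow> complex" where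
  "torus_monomial = (\<lambda>(\<beta>, is, js) x. \<beta> x * (\<Prod>i\<leftarrow>is. x $ i $ 1 $ 2) * (\<Prod>j\<leftarrow>js. x $ j $ 2 $ 1))"

lemma sum_list_product:
  "(\<Sum>m\<leftarrow>ms. f m) * (\<Sum>m\<leftarrow>ms'. g m) = (\<Sum>(m, m')\<leftarrow>List.product ms ms'. f m * g m' :: 'a::semiring_0)"
  by (induction ms) (simp_all add: distrib_right sum_list_const_mult comp_def)

lemma torus_expansion:
  assumes "f \<in> polynomial_functions"
  shows "\<exists>ms. (\<forall>m\<in>set ms. fst m \<in> torus_alg) \<and> (\<forall>x. f x = (\<Sum>m\<leftarrow>ms. torus_monomial m x))"
  using assms unfolding polynomial_functions_def
proof induction
  case (const c)
  show ?case
    by (intro exI[of _ "[(\<lambda>_. c, [], [])]"]) (simp add: torus_monomial_def torus_alg_def generated_subalgebra.const)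
next
  case (gen f)
  then obtain i j k where f: "f = (\<lambda>x. x $ i $ j $ k)" by blast
  have one: "(\<lambda>_. 1) \<in> torus_alg" unfolding torus_alg_def by (rule generated_subalgebra.const)
  have diag: "(\<lambda>x. x $ i $ 1 $ 1) \<in> torus_alg" "(\<lambda>x. x $ i $ 2 $ 2) \<in> torus_alg"
    unfolding torus_alg_def by (rule generated_subalgebra.gen; blast)+
  consider "j = 1" "k = 1" | "j = 1" "k = 2" | "j = 2" "k = 1" | "j = 2" "k = 2"
    using exhaust_2[of j] exhaust_2[of k] by blast
  then show ?case
  proof cases
    case 1 then show ?thesis using diag
      by (intro exI[of _ "[(\<lambda>x. x $ i $ 1 $ 1, [], [])]"]) (simp add: f torus_monomial_def)
  next
    case 2 then show ?thesis using one
      by (intro exI[of _ "[(\<lambda>_. 1, [i], [])]"]) (simp add: f torus_monomial_def)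
  next
    case 3 then show ?thesis using one
      by (intro exI[of _ "[(\<lambda>_. 1, [], [i])]"]) (simp add: f torus_monomial_def)
  next
    case 4 then show ?thesis using diag
      by (intro exI[of _ "[(\<lambda>x. x $ i $ 2 $ 2, [], [])]"]) (simp add: f torus_monomial_def)
  qed
next
  case (add f g)
  then obtain ms ms' where "\<forall>m\<in>set ms. fst m \<in> torus_alg" "\<forall>x. f x = (\<Sum>m\<leftarrow>ms. torus_monomial m x)"
    "\<forall>m\<in>set ms'. fst m \<in> torus_alg" "\<forall>x. g x = (\<Sum>m\<leftarrow>ms'. torus_monomial m x)" by blast
  then show ?case by (intro exI[of _ "ms @ ms'"]) auto
next
  case (mult f g)
  then obtain ms ms' where ms: "\<forall>m\<in>set ms. fst m \<in> torus_alg" "\<forall>x. f x = (\<Sum>m\<leftarrow>ms. torus_monomial m x)"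
    "\<forall>m\<in>set ms'. fst m \<in> torus_alg" "\<forall>x. g x = (\<Sum>m\<leftarrow>ms'. torus_monomial m x)" by blast
  define mul :: "torus_monomial \<times> torus_monomial \<Rightarrow> torus_monomial" where
    "mul = (\<lambda>((\<beta>, is, js), (\<beta>', is', js')). (\<beta> * \<beta>', is @ is', js @ js'))"
  have mul: "torus_monomial (mul mm) x = torus_monomial (fst mm) x * torus_monomial (snd mm) x" for mm x
    by (simp add: mul_def torus_monomial_def case_prod_beta mult_ac)
  have "fst (mul mm) \<in> torus_alg" if "fst (fst mm) \<in> torus_alg" "fst (snd mm) \<in> torus_alg" for mm
    using that unfolding torus_alg_def mul_def case_prod_beta fst_conv by (rule generated_subalgebra.mult)
  then have "\<forall>m\<in>set (map mul (List.product ms ms')). fst m \<in> torus_alg"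
    using ms(1,3) by (simp add: ball_simps)
  moreover have "(f * g) x = (\<Sum>m\<leftarrow>map mul (List.product ms ms'). torus_monomial m x)" for x
  proof -
    have "(f * g) x = (\<Sum>(m, m')\<leftarrow>List.product ms ms'. torus_monomial m x * torus_monomial m' x)"
      using ms(2,4) by (simp only: times_fun_apply sum_list_product)
    then show ?thesis by (simp add: comp_def case_prod_unfold mul)
  qed
  ultimately show ?case by blast
qed

lemma torus_alg_torus:
  assumes "\<beta> \<in> torus_alg" "z \<noteq> 0"
  shows "\<beta> (\<chi> i. mat22 (x $ i $ 1 $ 1) (z * x $ i $ 1 $ 2) (x $ i $ 2 $ 1 / z) (x $ i $ 2 $ 2)) = \<beta> x"
  using assms(1) unfolding torus_alg_def by induction (use assms(2) in auto)

text \<open>The weight may be negative; placing a power of \<open>z\<close> on either side keeps all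
  exponents natural.\<close>

lemma torus_monomial_torus:
  assumes "fst m \<in> torus_alg" "z \<noteq> 0"
  shows "torus_monomial m (\<chi> i. mat22 (x $ i $ 1 $ 1) (z * x $ i $ 1 $ 2) (x $ i $ 2 $ 1 / z) (x $ i $ 2 $ 2))
    * z ^ length (snd (snd m)) = z ^ length (fst (snd m)) * torus_monomial m x"
proof -
  obtain \<beta> "is" js where m: "m = (\<beta>, is, js)" by (cases m)
  have "(\<Prod>i\<leftarrow>is. z * x $ i $ 1 $ 2) = z ^ length is * (\<Prod>i\<leftarrow>is. x $ i $ 1 $ 2)" by (induction "is") simp_all
  moreover have "(\<Prod>j\<leftarrow>js. x $ j $ 2 $ 1 / z) * z ^ length js = (\<Prod>j\<leftarrow>js. x $ j $ 2 $ 1)"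
    using assms(2) by (induction js) (simp_all add: field_simps)
  ultimately show ?thesis
    using torus_alg_torus[of \<beta> z x] assms by (simp add: m torus_monomial_def mult_ac)
qed

text \<open>Lists of equal length are paired entry by entry, and each pair is a generator of
  \<open>torus_alg\<close>.\<close>

lemma balanced_torus_monomial:
  assumes "fst m \<in> torus_alg" "length (fst (snd m)) = length (snd (snd m))"
  shows "torus_monomial m \<in> torus_alg"
proof -
  obtain \<beta> "is" js where m: "m = (\<beta>, is, js)" by (cases m)
  have "length is = length js" using assms(2) m by simp
  then have "(\<lambda>x. (\<Prod>i\<leftarrow>is. x $ i $ 1 $ 2) * (\<Prod>j\<leftarrow>js. x $ j $ 2 $ 1)) \<in> torus_alg"
  proof (induction "is" js rule: list_induct2)
    case Nil
    show ?case unfolding torus_alg_def by (simp add: generated_subalgebra.const)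
  next
    case (Cons i "is" j js)
    have "(\<lambda>x. x $ i $ 1 $ 2 * x $ j $ 2 $ 1) \<in> torus_alg"
      unfolding torus_alg_def by (rule generated_subalgebra.gen) blast
    then have "(\<lambda>x. x $ i $ 1 $ 2 * x $ j $ 2 $ 1) * (\<lambda>x. (\<Prod>i\<leftarrow>is. x $ i $ 1 $ 2) * (\<Prod>j\<leftarrow>js. x $ j $ 2 $ 1)) \<in> torus_alg"
      using Cons.IH unfolding torus_alg_def by (rule generated_subalgebra.mult)
    moreover have "(\<lambda>x :: mat2_tuple. x $ i $ 1 $ 2 * x $ j $ 2 $ 1) * (\<lambda>x. (\<Prod>i\<leftarrow>is. x $ i $ 1 $ 2) * (\<Prod>j\<leftarrow>js. x $ j $ 2 $ 1))
      = (\<lambda>x. (\<Prod>i\<leftarrow>i # is. x $ i $ 1 $ 2) * (\<Prod>j\<leftarrow>j # js. x $ j $ 2 $ 1))"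
      by (simp add: fun_eq_iff mult_ac)
    ultimately show ?case by (simp only:)
  qed
  then have "\<beta> * (\<lambda>x. (\<Prod>i\<leftarrow>is. x $ i $ 1 $ 2) * (\<Prod>j\<leftarrow>js. x $ j $ 2 $ 1)) \<in> torus_alg"
    using assms(1) unfolding m torus_alg_def fst_conv by (intro generated_subalgebra.mult)
  moreover have "torus_monomial m = \<beta> * (\<lambda>x. (\<Prod>i\<leftarrow>is. x $ i $ 1 $ 2) * (\<Prod>j\<leftarrow>js. x $ j $ 2 $ 1))"
    by (simp add: m torus_monomial_def fun_eq_iff mult.assoc)
  ultimately show ?thesis by (simp only:)
qed

lemma poly_sum_list_monom: "poly (\<Sum>m\<leftarrow>ms. monom (g m) (e m)) z = (\<Sum>m\<leftarrow>ms. g m * z ^ e m :: 'a::comm_semiring_1)"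
  by (induction ms) (simp_all add: poly_monom)

lemma coeff_sum_list_monom:
  "coeff (\<Sum>m\<leftarrow>ms. monom (g m) (e m)) k = (\<Sum>m\<leftarrow>filter (\<lambda>m. e m = k) ms. g m)"
  by (induction ms) simp_all

text \<open>Along the torus orbit of a fixed \<open>x\<close>, the expansion of \<open>f\<close>
  times \<open>z ^ K\<close> is a polynomial in \<open>z\<close>, whereas invariance makes it the
  single monomial \<open>f x * z ^ K\<close>. Comparing coefficients at \<open>z ^ K\<close> keeps
  only the monomials of weight zero.\<close>

lemma T4_torus_alg:
  assumes f: "f \<in> T4" shows "f \<in> torus_alg"
proof -
  obtain ms where ms: "\<forall>m\<in>set ms. fst m \<in> torus_alg" "\<And>x. f x = (\<Sum>m\<leftarrow>ms. torus_monomial m x)"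
    using torus_expansion f unfolding T4_iff by blast
  \<comment> \<open>\<open>K\<close> bounds the number of lower left entries, so the subtraction in
    \<open>e m\<close> is never truncated and weight zero means \<open>e m = K\<close>.\<close>
  define K where "K = Max (insert 0 ((\<lambda>m. length (snd (snd m))) ` set ms))"
  have K: "length (snd (snd m)) \<le> K" if "m \<in> set ms" for m
    unfolding K_def using that by (intro Max_ge) auto
  define e where "e m = K - length (snd (snd m)) + length (fst (snd m))" for m :: torus_monomial
  define bal where "bal = filter (\<lambda>m. e m = K) ms"
  have "f x = (\<Sum>m\<leftarrow>bal. torus_monomial m x)" for x
  proof -
    define p where "p = (\<Sum>m\<leftarrow>ms. monom (torus_monomial m x) (e m)) - monom (f x) K"
    have "p = 0"
    proof (rule poly_eq_0_if_infinitely_many[of "{0}"])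
      fix z :: complex assume "z \<notin> {0}"
      then have z: "z \<noteq> 0" by simp
      define x' where "x' = (\<chi> i. mat22 (x $ i $ 1 $ 1) (z * x $ i $ 1 $ 2) (x $ i $ 2 $ 1 / z) (x $ i $ 2 $ 2))"
      have "torus_monomial m x * z ^ e m = torus_monomial m x' * z ^ K" if m: "m \<in> set ms" for m
      proof -
        have "torus_monomial m x' * z ^ K
          = (torus_monomial m x' * z ^ length (snd (snd m))) * z ^ (K - length (snd (snd m)))"
          using K[OF m] by (simp add: mult.assoc flip: power_add)
        then show ?thesis
          using torus_monomial_torus[of m z x, folded x'_def] ms(1) m z by (simp add: e_def power_add mult_ac)
      qed
      then have "(\<Sum>m\<leftarrow>ms. torus_monomial m x * z ^ e m) = (\<Sum>m\<leftarrow>ms. torus_monomial m x' * z ^ K)"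
        by (intro arg_cong[where f = sum_list] map_cong refl)
      also have "\<dots> = f x' * z ^ K" unfolding ms(2) by (rule sum_list_mult_const)
      also have "f x' = f x" unfolding x'_def using f z by (rule T4_torus)
      finally show "poly p z = 0" unfolding p_def by (simp add: poly_sum_list_monom poly_monom)
    qed simp
    then have "coeff p K = 0" by simp
    then show ?thesis unfolding p_def bal_def by (simp add: coeff_sum_list_monom)
  qed
  then have "f = (\<Sum>m\<leftarrow>bal. torus_monomial m)"
  proof -
    have "(\<Sum>m\<leftarrow>bal. torus_monomial m) x = (\<Sum>m\<leftarrow>bal. torus_monomial m x)" for x by (induction bal) simp_all
    then show ?thesis using \<open>\<And>x. f x = (\<Sum>m\<leftarrow>bal. torus_monomial m x)\<close> by (simp add: fun_eq_iff)
  qed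
  moreover have "torus_monomial m \<in> torus_alg" if "m \<in> set bal" for m
    using that K[of m] ms(1) unfolding bal_def e_def by (intro balanced_torus_monomial) auto
  then have "(\<Sum>m\<leftarrow>bal. torus_monomial m) \<in> torus_alg"
  proof (induction bal)
    case Nil
    show ?case unfolding torus_alg_def list.map sum_list.Nil by (rule generated_subalgebra_0)
  next
    case (Cons m ms)
    have "torus_monomial m \<in> torus_alg" "(\<Sum>m\<leftarrow>ms. torus_monomial m) \<in> torus_alg" using Cons by simp_all
    then show ?case unfolding torus_alg_def list.map sum_list.Cons by (rule generated_subalgebra.add)
  qed
  ultimately show ?thesis by (simp only:)
qed

section \<open>Generation of the ring of invariants\<close>

text \<open>Such expressions are closed under products since \<open>ent_p 1\<close> squares to \<open>s\<^sub>1\<^sub>1 / 2\<close> where the first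
  matrix is diagonal.\<close>

definition slice_expressible :: "(mat2_tuple \<Rightarrow> complex) \<Rightarrow> nat \<Rightarrow> (mat2_tuple \<Rightarrow> complex) \<Rightarrow> (mat2_tuple \<Rightarrow> complex) \<Rightarrow> bool" where
  "slice_expressible h k F G \<longleftrightarrow> F \<in> trace_alg \<and> G \<in> trace_alg \<and>
    (\<forall>x. ent_q 1 x = 0 \<longrightarrow> ent_r 1 x = 0 \<longrightarrow> h x * s_fun [1,1] x ^ k = F x + ent_p 1 x * G x)"

lemmas trace_alg_intros = generated_subalgebra_intros[where
  G = "{t_fun [i] | i. True} \<union> {s_fun [i, j] | i j. True} \<union> {s_fun [1, i, j] | i j. True}", folded trace_alg_def]

lemma slice_s11: "ent_q 1 x = 0 \<Longrightarrow> s_fun [1,1] x = 2 * (ent_p 1 x)\<^sup>2"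
  by (simp add: s_fun_2 power2_eq_square)

lemma slice_diagonal:
  assumes "ent_q 1 x = 0" "ent_r 1 x = 0"
  shows "ent_p i x * s_fun [1,1] x = ent_p 1 x * s_fun [1, i] x"
  using assms by (simp add: s_fun_2)

text \<open>On the slice \<open>s_1ij\<close> is \<open>p_1 * (q_i * r_j - r_i * q_j)\<close>, the
  antisymmetric part, while \<open>s_ij\<close> and \<open>s_1i * s_1j\<close> give the symmetric
  part; together they isolate \<open>q_i * r_j\<close>.\<close>

lemma slice_product:
  assumes "ent_q 1 x = 0" "ent_r 1 x = 0"
  shows "2 * (ent_q i x * ent_r j x) * s_fun [1,1] x
    = s_fun [i, j] x * s_fun [1,1] x - s_fun [1, i] x * s_fun [1, j] x + 2 * ent_p 1 x * s_fun [1, i, j] x"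
  unfolding s_fun_2 s_fun_3 assms by algebra

lemma entries_ent: "x $ i $ 1 $ 1 = t_fun [i] x / 2 + ent_p i x" "x $ i $ 2 $ 2 = t_fun [i] x / 2 - ent_p i x"
  by (simp_all add: t_fun_1 ent_p_def field_simps)

lemma torus_alg_slice:
  assumes "h \<in> torus_alg"
  shows "\<exists>k F G. slice_expressible h k F G"
  using assms unfolding torus_alg_def
proof induction
  case (const c)
  show ?case
    unfolding slice_expressible_def
    by (intro exI[of _ 0] exI[of _ "\<lambda>_. c"] exI[of _ "\<lambda>_. 0"]) (simp add: trace_alg_intros(1))
next
  case (gen h)
  then consider i where "h = (\<lambda>x. x $ i $ 1 $ 1)" | i where "h = (\<lambda>x. x $ i $ 2 $ 2)"
    | i j where "h = (\<lambda>x. ent_q i x * ent_r j x)"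
    unfolding ent_q_def ent_r_def by blast
  then show ?case
  proof cases
    case (1 i)
    have "slice_expressible h 1 ((\<lambda>_. 1 / 2) * t_fun [i] * s_fun [1,1]) (s_fun [1, i])"
      unfolding slice_expressible_def 1 entries_ent
    proof (intro conjI allI impI trace_alg_intros(1,3,6) trace_alg_gens)
      fix x assume "ent_q 1 x = 0" "ent_r 1 x = 0"
      from slice_diagonal[OF this, of i]
      show "(t_fun [i] x / 2 + ent_p i x) * s_fun [1,1] x ^ 1
        = ((\<lambda>_. 1 / 2) * t_fun [i] * s_fun [1,1]) x + ent_p 1 x * (s_fun [1, i]) x"
        by (simp add: algebra_simps)
    qed
    then show ?thesis by blast
  next
    case (2 i)
    have "slice_expressible h 1 ((\<lambda>_. 1 / 2) * t_fun [i] * s_fun [1,1]) (- s_fun [1, i])"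
      unfolding slice_expressible_def 2 entries_ent
    proof (intro conjI allI impI trace_alg_intros(1,3,6) trace_alg_gens)
      fix x assume "ent_q 1 x = 0" "ent_r 1 x = 0"
      from slice_diagonal[OF this, of i]
      show "(t_fun [i] x / 2 - ent_p i x) * s_fun [1,1] x ^ 1
        = ((\<lambda>_. 1 / 2) * t_fun [i] * s_fun [1,1]) x + ent_p 1 x * (- s_fun [1, i]) x"
        by (simp add: algebra_simps)
    qed
    then show ?thesis by blast
  next
    case (3 i j)
    have "slice_expressible h 1 ((\<lambda>_. 1 / 2) * (s_fun [i, j] * s_fun [1,1] - s_fun [1, i] * s_fun [1, j])) (s_fun [1, i, j])"
      unfolding slice_expressible_def 3
    proof (intro conjI allI impI trace_alg_intros(1,3,7) trace_alg_gens)
      fix x assume "ent_q 1 x = 0" "ent_r 1 x = 0"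
      from slice_product[OF this, of i j]
      show "ent_q i x * ent_r j x * s_fun [1,1] x ^ 1
        = ((\<lambda>_. 1 / 2) * (s_fun [i, j] * s_fun [1,1] - s_fun [1, i] * s_fun [1, j])) x + ent_p 1 x * s_fun [1, i, j] x"
        by (simp add: field_simps)
    qed
    then show ?thesis by blast
  qed
next
  case (add f g)
  then obtain k F G k' F' G' where "slice_expressible f k F G" "slice_expressible g k' F' G'" by blast
  then have "slice_expressible (f + g) (k + k') (F * s_fun [1,1] ^ k' + F' * s_fun [1,1] ^ k)
      (G * s_fun [1,1] ^ k' + G' * s_fun [1,1] ^ k)"
    unfolding slice_expressible_def
  proof (intro conjI allI impI; (elim conjE)?)
    fix x
    assume fg: "\<forall>x. ent_q 1 x = 0 \<longrightarrow> ent_r 1 x = 0 \<longrightarrow> f x * s_fun [1,1] x ^ k = F x + ent_p 1 x * G x"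
      "\<forall>x. ent_q 1 x = 0 \<longrightarrow> ent_r 1 x = 0 \<longrightarrow> g x * s_fun [1,1] x ^ k' = F' x + ent_p 1 x * G' x"
      and x: "ent_q 1 x = 0" "ent_r 1 x = 0"
    have "(f + g) x * s_fun [1,1] x ^ (k + k') = (f x * s_fun [1,1] x ^ k) * s_fun [1,1] x ^ k'
      + (g x * s_fun [1,1] x ^ k') * s_fun [1,1] x ^ k" by (simp add: power_add algebra_simps)
    also have "f x * s_fun [1,1] x ^ k = F x + ent_p 1 x * G x" using fg(1) x by blast
    also have "g x * s_fun [1,1] x ^ k' = F' x + ent_p 1 x * G' x" using fg(2) x by blast
    finally show "(f + g) x * s_fun [1,1] x ^ (k + k') = (F * s_fun [1,1] ^ k' + F' * s_fun [1,1] ^ k) x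
      + ent_p 1 x * (G * s_fun [1,1] ^ k' + G' * s_fun [1,1] ^ k) x"
      by (simp add: power_fun_apply algebra_simps)
  qed (intro trace_alg_intros(2,3,8) trace_alg_gens; assumption)+
  then show ?case by blast
next
  case (mult f g)
  then obtain k F G k' F' G' where "slice_expressible f k F G" "slice_expressible g k' F' G'" by blast
  then have "slice_expressible (f * g) (k + k') (F * F' + (\<lambda>_. 1 / 2) * s_fun [1,1] * (G * G')) (F * G' + G * F')"
    unfolding slice_expressible_def
  proof (intro conjI allI impI; (elim conjE)?)
    fix x
    assume fg: "\<forall>x. ent_q 1 x = 0 \<longrightarrow> ent_r 1 x = 0 \<longrightarrow> f x * s_fun [1,1] x ^ k = F x + ent_p 1 x * G x"
      "\<forall>x. ent_q 1 x = 0 \<longrightarrow> ent_r 1 x = 0 \<longrightarrow> g x * s_fun [1,1] x ^ k' = F' x + ent_p 1 x * G' x"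
      and x: "ent_q 1 x = 0" "ent_r 1 x = 0"
    have "(f * g) x * s_fun [1,1] x ^ (k + k') = (f x * s_fun [1,1] x ^ k) * (g x * s_fun [1,1] x ^ k')"
      by (simp add: power_add algebra_simps)
    also have "f x * s_fun [1,1] x ^ k = F x + ent_p 1 x * G x" using fg(1) x by blast
    also have "g x * s_fun [1,1] x ^ k' = F' x + ent_p 1 x * G' x" using fg(2) x by blast
    finally show "(f * g) x * s_fun [1,1] x ^ (k + k') = (F * F' + (\<lambda>_. 1 / 2) * s_fun [1,1] * (G * G')) x
      + ent_p 1 x * (F * G' + G * F') x"
      using slice_s11[OF x(1)] by (simp add: power2_eq_square algebra_simps)
  qed (intro trace_alg_intros(1,2,3) trace_alg_gens; assumption)+
  then show ?case by blast
qed

section \<open>From the diagonal slice to all tuples\<close>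

lemma diagonalise:
  assumes l: "l\<^sup>2 = (ent_p 1 x)\<^sup>2 + ent_q 1 x * ent_r 1 x" and nz: "l \<noteq> 0" "ent_q 1 x * ent_r 1 x \<noteq> 0"
  obtains g where "invertible g" "ent_p 1 (conj_tuple g x) = l" "ent_q 1 (conj_tuple g x) = 0" "ent_r 1 (conj_tuple g x) = 0"
proof -
  define p q r t where "p = ent_p 1 x" and "q = ent_q 1 x" and "r = ent_r 1 x" and "t = t_fun [1] x / 2"
  have l': "l * l = p * p + q * r" using l by (simp add: p_def q_def r_def power2_eq_square)
  have x1: "x $ 1 = mat22 (t + p) q r (t - p)"
    by (simp add: vec_eq_iff forall_2 p_def q_def r_def t_def ent_p_def ent_q_def ent_r_def t_fun_1 field_simps)
  \<comment> \<open>The rows are left eigenvectors of the traceless part for \<open>l\<close> and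
    \<open>- l\<close>. The determinant is \<open>2 * l * (l + p)\<close>, and
    \<open>l + p = 0\<close> would force \<open>q * r = 0\<close>.\<close>
  define g where "g = mat22 (l + p) q (- r) (l + p)"
  have "l + p \<noteq> 0"
  proof
    assume "l + p = 0"
    then have "l = - p" by (simp add: eq_neg_iff_add_eq_0)
    then show False using l' nz by (simp add: q_def r_def)
  qed
  have "(l + p) * (l + p) - q * (- r) = 2 * l * (l + p)" using l' by algebra
  then have g: "invertible g" using nz(1) \<open>l + p \<noteq> 0\<close> unfolding g_def invertible_mat22 by simp
  have "g ** x $ 1 = mat22 (t + l) 0 0 (t - l) ** g"
    unfolding x1 g_def using l'
    by (simp add: vec_eq_iff forall_2 matrix_matrix_mult_def sum_2 algebra_simps)
  then have "conj_tuple g x $ 1 = mat22 (t + l) 0 0 (t - l) ** g ** matrix_inv g"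
    by (simp add: conj_tuple_def)
  also have "\<dots> = mat22 (t + l) 0 0 (t - l)"
    using g by (simp add: matrix_mul_assoc[symmetric] matrix_inv_cancel)
  finally have "conj_tuple g x $ 1 = mat22 (t + l) 0 0 (t - l)" .
  then show ?thesis using that[OF g] by (simp add: ent_p_def ent_q_def ent_r_def)
qed

lemma ent_polynomial: "ent_q i \<in> polynomial_functions" "ent_r i \<in> polynomial_functions"
  using entry_polynomial by (simp_all add: ent_q_def[abs_def] ent_r_def[abs_def])

lemma polynomial_functions_mult: "f \<in> polynomial_functions \<Longrightarrow> g \<in> polynomial_functions \<Longrightarrow> f * g \<in> polynomial_functions"
  unfolding polynomial_functions_def by (rule generated_subalgebra.mult)

text \<open>The tuple can be conjugated into the slice with either root \<open>l\<close> or
  \<open>- l\<close> as the value of \<open>ent_p 1\<close>. Since \<open>f\<close>,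
  \<open>F\<close> and \<open>G\<close> are invariant, the two resulting equations eliminate
  \<open>G\<close>. The identity so obtained where \<open>d\<close> is nonzero extends to all
  tuples.\<close>

lemma T4_localised:
  assumes f: "f \<in> T4" shows "\<exists>k. s_fun [1,1] ^ k * f \<in> trace_alg"
proof -
  obtain k F G where "slice_expressible f k F G" using torus_alg_slice[OF T4_torus_alg[OF f]] by blast
  then have F: "F \<in> trace_alg" and G: "G \<in> trace_alg"
    and slice: "\<And>x. ent_q 1 x = 0 \<Longrightarrow> ent_r 1 x = 0 \<Longrightarrow> f x * s_fun [1,1] x ^ k = F x + ent_p 1 x * G x"
    unfolding slice_expressible_def by blast+
  have inv: "h (conj_tuple g x) = h x" if "h \<in> T4" "invertible g" for h g x
    using that unfolding T4_iff by blast
  define d where "d = ent_q 1 * ent_r 1 * s_fun [1,1]"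
  have "d x * (s_fun [1,1] ^ k * f) x = d x * F x" for x
  proof (cases "d x = 0")
    case False
    then have nz: "ent_q 1 x * ent_r 1 x \<noteq> 0" "s_fun [1,1] x \<noteq> 0" by (auto simp: d_def)
    define l where "l = csqrt ((ent_p 1 x)\<^sup>2 + ent_q 1 x * ent_r 1 x)"
    have l: "l\<^sup>2 = (ent_p 1 x)\<^sup>2 + ent_q 1 x * ent_r 1 x" by (simp add: l_def)
    have "s_fun [1,1] x = 2 * l\<^sup>2" unfolding l by (simp add: s_fun_2 power2_eq_square)
    then have "l \<noteq> 0" using nz(2) by auto
    have *: "f x * s_fun [1,1] x ^ k = F x + l' * G x" if l': "l'\<^sup>2 = l\<^sup>2" for l'
    proof -
      have "l' \<noteq> 0" using l' \<open>l \<noteq> 0\<close> by auto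
      obtain g where "invertible g" "ent_p 1 (conj_tuple g x) = l'" "ent_q 1 (conj_tuple g x) = 0" "ent_r 1 (conj_tuple g x) = 0"
        using diagonalise[OF l'[unfolded l] \<open>l' \<noteq> 0\<close> nz(1)] by blast
      then show ?thesis
        using slice[of "conj_tuple g x"] inv[OF f] inv[OF trace_alg_T4[OF F]] inv[OF trace_alg_T4[OF G]]
        by (simp add: s_fun_conj)
    qed
    have "f x * s_fun [1,1] x ^ k = F x" using *[of l] *[of "- l"] by simp
    then show ?thesis by (simp add: power_fun_apply mult.commute)
  qed simp
  moreover have "d \<in> polynomial_functions"
    unfolding d_def by (intro polynomial_functions_mult ent_polynomial T4_polynomial s_fun_2_T4)
  moreover have "s_fun [1,1] ^ k * f \<in> polynomial_functions"
    by (intro T4_polynomial T4_mult T4_power s_fun_2_T4 f)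
  moreover have "F \<in> polynomial_functions" by (intro T4_polynomial trace_alg_T4 F)
  moreover have "d (entries_tuple (\<lambda>_. 0) (\<lambda>_. 0) (\<lambda>_. 1) (\<lambda>_. 1)) \<noteq> 0" by (simp add: d_def s_fun_2)
  ultimately have "s_fun [1,1] ^ k * f = F" by (intro polynomial_functions_cancel[of d]) blast+
  then show ?thesis using F by blast
qed

section \<open>Removal of the powers of \<open>s_fun [1,1]\<close>\<close>

lemma combination_E_span:
  assumes "\<And>c k. c < 8 \<Longrightarrow> k < K \<Longrightarrow> P c k \<in> coord_polys"
  shows "combination K P \<in> E_span"
proof -
  have sum: "(\<Sum>i\<in>I. f i) \<in> E_span" if "\<And>i. i \<in> I \<Longrightarrow> f i \<in> E_span" for f and I :: "nat set"
    using that by (induction I rule: infinite_finite_induct) (simp_all only: sum.infinite sum.empty sum.insert module_span_0 E_span_add insert_iff simp_thms)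
  show ?thesis
    unfolding combination_def
    by (intro sum E_span_scale coord_polys_gens_R_alg assms E_elem_E_span) simp_all
qed

text \<open>By \<open>combination_divide\<close> the factor \<open>s_fun [1,1]\<close> can be
  divided out coefficient by coefficient, so the quotient is again a combination of basis
  elements.\<close>

lemma E_span_saturated:
  assumes g: "g \<in> polynomial_functions" and sg: "s_fun [1,1] * g \<in> E_span"
  shows "g \<in> E_span"
proof -
  obtain F c where F: "finite F" "F \<subseteq> E_set" "\<forall>b\<in>F. c b \<in> R_alg" "s_fun [1,1] * g = (\<Sum>b\<in>F. c b * b)"
    using sg unfolding module_span_def by blast
  obtain K P where P: "\<And>c k. P c k \<in> coord_polys" and eq: "(\<Sum>b\<in>F. c b * b) = combination K P"
    by (rule sum_E_set_combination[OF F(1-3)]) blast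
  show ?thesis
  proof (rule combination_divide[where P = P and K = K and f = g])
    show "P c k \<in> coord_polys" for c k by (rule P)
    show "g \<in> polynomial_functions" by (rule g)
    show "combination K P x = s_fun [1,1] x * g x" for x
      using fun_cong[OF F(4)[unfolded eq], of x] by simp
  next
    fix Q
    assume "\<And>c k. c < 8 \<Longrightarrow> k < K \<Longrightarrow> Q c k \<in> coord_polys" and g: "combination K Q = g"
    then have "combination K Q \<in> E_span" by (intro combination_E_span)
    then show ?thesis unfolding g .
  qed
qed

lemma T4_E_span: "f \<in> T4 \<Longrightarrow> f \<in> E_span"
proof -
  assume f: "f \<in> T4"
  obtain k where "s_fun [1,1] ^ k * f \<in> E_span" using T4_localised[OF f] trace_alg_E_span by blast
  then show "f \<in> E_span"
  proof (induction k)
    case (Suc k)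
    have "s_fun [1,1] * (s_fun [1,1] ^ k * f) \<in> E_span" using Suc.prems by (simp only: power_Suc mult.assoc)
    moreover have "s_fun [1,1] ^ k * f \<in> polynomial_functions"
      by (intro T4_polynomial T4_mult T4_power s_fun_2_T4 f)
    ultimately have "s_fun [1,1] ^ k * f \<in> E_span" by (rule E_span_saturated[rotated])
    then show ?case by (rule Suc.IH)
  qed simp
qed

theorem theorem3p3:
  shows "R_alg \<subseteq> T4 \<and> algebraically_independent R_generators \<and> freely_generated R_alg T4 E_set"
  unfolding freely_generated_def
  using R_alg_T4 R_generators_independent T4_E_span module_span_T4 E_set_independent by blast

end
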